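(* For every $x>0$ and every positive integer $k$, $${}_1\Psi_1\left(-\tfrac13,k;-\tfrac13,0;-x\right)=\frac{x^{3/2}}{3\pi}\int_0^\infty e^{-t}\,t^{k-3/2}\,K_{1/3}\!\left(\frac{2x^{3/2}}{3\sqrt{3t}}\right)dt$$ and $${}_1\Psi_1\left(-\tfrac23,k;-\tfrac23,0;-x\right)=\sqrt{\frac{3}{\pi}}\int_0^\infty e^{-t}\,t^{k-1}\exp\!\left(-\frac{2x^3}{27\,t^2}\right)W_{\frac12,\frac16}\!\left(\frac{4x^3}{27\,t^2}\right)dt .$$
   Context: For a positive integer $k$, real $\rho\ne0$ and real $z$, ${}_1\Psi_1(\rho,k;\rho,0;z)=\sum_{n=0}^\infty \frac{\Gamma(k+\rho n)}{\Gamma(\rho n)}\frac{z^n}{n!}$, where the quotient $\Gamma(k+\rho n)/\Gamma(\rho n)$ is understood (by a limit where necessary) as $\prod_{j=0}^{k-1}(\rho n+j)$. $K_\nu$ denotes the modified Bessel function of the second kind and $W_{\kappa,\mu}$ the Whittaker function. *)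

theory Defs
  imports "HOL-Analysis.Analysis"
begin

text \<open>
  The generalised Wright function \<open>1Psi1(rho, k; rho, 0; z)\<close>.  The quotient
  \<open>Gamma (k + rho n) / Gamma (rho n)\<close> is read as the product of the \<open>rho n + j\<close> with
  \<open>j < k\<close>; \<open>Gamma_quotient_limit\<close> shows that this is its limit also at the poles.
\<close>

definition wright_Psi11 :: "real \<Rightarrow> nat \<Rightarrow> real \<Rightarrow> real" where
  "wright_Psi11 \<rho> k z = (\<Sum>n. pochhammer (\<rho> * real n) k * z ^ n / fact n)"

lemma Gamma_quotient_limit:
  fixes z :: real
  shows "((\<lambda>w. Gamma (real k + w) / Gamma w) \<longlongrightarrow> pochhammer z k) (at z)"
proof (rule Lim_transform_eventually)
  show "((\<lambda>w. pochhammer w k) \<longlongrightarrow> pochhammer z k) (at z)"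
    unfolding pochhammer_prod by (intro tendsto_intros)
  have "z islimpt \<int>\<^sub>\<le>\<^sub>0 \<Longrightarrow> False"
    using discrete_imp_not_islimpt[of 1 "\<int>\<^sub>\<le>\<^sub>0 :: real set" z]
    by (force elim!: nonpos_Ints_cases simp: dist_real_def)
  then have "eventually (\<lambda>w. w \<notin> \<int>\<^sub>\<le>\<^sub>0) (at z)"
    unfolding islimpt_iff_eventually by auto
  then show "eventually (\<lambda>w. pochhammer w k = Gamma (real k + w) / Gamma w) (at z)"
    by eventually_elim (simp add: pochhammer_Gamma add.commute)
qed

text \<open>
  Real order and positive real argument.  For integer order the quotient defining
  \<open>K\<close> is 0/0 and is replaced by its limit in the order.
\<close>

definition bessel_I :: "real \<Rightarrow> real \<Rightarrow> real" where
  "bessel_I \<nu> x = (\<Sum>m. (x / 2) powr (2 * real m + \<nu>) / fact m * rGamma (real m + \<nu> + 1))"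

definition bessel_K :: "real \<Rightarrow> real \<Rightarrow> real" where
  "bessel_K \<nu> x =
     (let K = (\<lambda>\<nu>. pi / 2 * (bessel_I (- \<nu>) x - bessel_I \<nu> x) / sin (\<nu> * pi))
      in if \<nu> \<in> \<int> then Lim (at \<nu>) K else K \<nu>)"

definition kummer_M :: "real \<Rightarrow> real \<Rightarrow> real \<Rightarrow> real" where
  "kummer_M a b x = (\<Sum>n. pochhammer a n / pochhammer b n * x ^ n / fact n)"

definition whittaker_M :: "real \<Rightarrow> real \<Rightarrow> real \<Rightarrow> real" where
  "whittaker_M \<kappa> \<mu> x =
     exp (- x / 2) * x powr (1/2 + \<mu>) * kummer_M (1/2 + \<mu> - \<kappa>) (1 + 2 * \<mu>) x"

text \<open>
  Again for real parameters and positive real argument, by the connection formula with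
  \<open>M(kappa, mu)\<close> and \<open>M(kappa, -mu)\<close>, which has to be replaced by its limit in \<open>mu\<close> when
  \<open>2 mu\<close> is an integer.  The reciprocal \<open>rGamma\<close> vanishes at the poles of \<open>Gamma\<close>.
\<close>

definition whittaker_W :: "real \<Rightarrow> real \<Rightarrow> real \<Rightarrow> real" where
  "whittaker_W \<kappa> \<mu> x =
     (let W = (\<lambda>\<mu>. Gamma (- 2 * \<mu>) * rGamma (1/2 - \<mu> - \<kappa>) * whittaker_M \<kappa> \<mu> x
                 + Gamma (2 * \<mu>) * rGamma (1/2 + \<mu> - \<kappa>) * whittaker_M \<kappa> (- \<mu>) x)
      in if 2 * \<mu> \<in> \<int> then Lim (at \<mu>) W else W \<mu>)"

end

(* For 0 < nu < 1 put F(z) = sum (- z)^n / (n! Gamma(- nu n)).  The function F(x t^(- nu)) / t is the inverse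
   Laplace transform of exp (- x s^nu) (a one-sided stable density), so the integral of
   e^(- t) t^(k - 1) F(x t^(- nu)) over t > 0 is (- 1)^k times the k-th derivative of exp (- x s^nu) at s = 1,
   and that derivative is the series 1Psi1(- nu, k; - nu, 0; - x).  Termwise integration diverges.  Instead,
   F is written by the reflection formula as the imaginary part of an integral along a ray arg s = phi with
   pi/2 < phi < pi and nu phi <= pi/2; after Fubini the t-integral is elementary, and the remaining integral
   over the ray and its conjugate is given by the residue at s = 1.  For nu = 1/3 and nu = 2/3 the series F,
   split according to n mod 3, is the one of K_(1/3) and of W_(1/2,1/6) up to elementary factors. *)
theory Submission
  imports Defs "HOL-Complex_Analysis.Complex_Analysis" "HOL-Real_Asymp.Real_Asymp"
begin

section \<open>Gamma integrals with complex scale\<close>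

text \<open>Integrated termwise, the n-th term of F carries t^(k - 1 - nu n), which is not
  integrable at 0 once nu n >= k; so the expansion in powers of x is made only at fixed t > 0,
  inside the ray integral. The two bounds on the angle have separate tasks: phi > pi/2 makes exp (t
  s) decay along the ray, and nu phi <= pi/2 keeps exp (- x s^nu) bounded by 1. Both can hold
  together exactly because nu < 1. With the factor e^(- t) the t-integral gets the scale 1 - s,
  whose real part is at least 1 on the ray, and the resulting (1 - s)^(- k - 1) is integrable along
  the ray because k > 0. The residue is computed in the coordinate w = log s: the ray and its
  conjugate become the lines Im w = phi and Im w = - phi, and s^nu becomes the entire function exp
  (nu w), so that no branch cut appears. Since x and nu are real, the second line is the conjugate
  of the first, which is why imaginary parts suffice throughout.\<close>

lemma has_bochner_integral_Gamma_real:
  fixes p b :: real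
  assumes p: "p > 0" and b: "b > 0"
  shows "has_bochner_integral lborel (\<lambda>r. indicator {0<..} r * (r powr (p - 1) * exp (- b * r)))
           (Gamma p / b powr p)"
proof -
  let ?f = "\<lambda>t::real. indicator {0..} t * t powr (p - 1) / exp t"
  have "(\<integral>\<^sup>+ t. ennreal (?f t) \<partial>lborel) = ennreal (Gamma p)"
    by (rule Gamma_conv_nn_integral_real[OF p, symmetric])
  then have "has_bochner_integral lborel ?f (Gamma p)"
    by (intro has_bochner_integral_nn_integral)
       (auto intro!: AE_I2 less_imp_le[OF Gamma_real_pos] simp: p)
  then have "has_bochner_integral lborel (\<lambda>r. ?f (0 + b * r)) (Gamma p /\<^sub>R \<bar>b\<bar>)"
    using b by (subst lborel_has_bochner_integral_real_affine_iff[of b, symmetric]) auto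
  then have "has_bochner_integral lborel (\<lambda>r. b powr (1 - p) * ?f (0 + b * r)) (b powr (1 - p) * (Gamma p /\<^sub>R \<bar>b\<bar>))"
    by (intro has_bochner_integral_mult_right)
  \<comment> \<open>The closed and the open half-line differ only at r = 0, where
    \<open>0 powr (p - 1) = 0\<close> makes both sides vanish.\<close>
  moreover have "b powr (1 - p) * ?f (0 + b * r) = indicator {0<..} r * (r powr (p - 1) * exp (- b * r))" for r
  proof (cases "r > 0")
    case True
    have "b powr (1 - p) * b powr (p - 1) = 1"
      using b by (simp flip: powr_add)
    then show ?thesis using True b
      by (simp add: powr_mult exp_minus divide_inverse flip: mult.assoc)
  next
    case False
    then consider "r = 0" | "r < 0" by linarith
    then show ?thesis
    proof cases
      case 1 then show ?thesis by simp
    next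
      case 2
      then have "b * r < 0" using b by (simp add: mult_pos_neg)
      then show ?thesis using 2 by (simp add: indicator_def)
    qed
  qed
  moreover have "b powr (1 - p) * (Gamma p /\<^sub>R \<bar>b\<bar>) = Gamma p / b powr p"
    using b by (simp add: powr_diff field_simps)
  ultimately show ?thesis by simp
qed

text \<open>Needed for two scales: - t cis \<phi> when the ray integral is expanded at fixed t, and
  1 - r cis \<phi> for the t-integral after Fubini. Both have positive real part because cos \<phi>
  < 0.\<close>

lemma has_bochner_integral_Gamma_complex:
  fixes p :: real and a :: complex
  assumes p: "p > 0" and a: "Re a > 0"
  shows "has_bochner_integral lborel
           (\<lambda>r. indicator {0<..} r *\<^sub>R (of_real (r powr (p - 1)) * exp (- a * of_real r)))
           (of_real (Gamma p) * a powr (- of_real p))"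
proof -
  \<comment> \<open>Expand around a real \<open>b\<close> so large that \<open>a\<close> lies in the disc of radius \<open>b\<close> about it;
    then this is the binomial series.\<close>
  define b where "b = (norm a)\<^sup>2 / Re a"
  have a0: "a \<noteq> 0" using a by auto
  have b: "b > 0" using a a0 by (simp add: b_def)
  define c where "c = (of_real b - a) / of_real b"
  \<comment> \<open>The disc condition amounts to |a|^2 < 2 b Re a; the choice of \<open>b\<close>
    makes the right side twice the left.\<close>
  have "(norm (of_real b - a))\<^sup>2 = b\<^sup>2 - 2 * b * Re a + (norm a)\<^sup>2"
    unfolding cmod_power2 by (simp add: power2_eq_square algebra_simps)
  also have "\<dots> = b\<^sup>2 - (norm a)\<^sup>2" using a by (simp add: b_def)
  also have "\<dots> < b\<^sup>2" using a0 by simp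
  finally have "norm (of_real b - a) < b"
    using b by (simp add: power2_less_imp_less)
  then have c: "norm c < 1" using b by (simp add: c_def norm_divide)
  define f where "f = (\<lambda>(n::nat) r. indicator {0<..} r *\<^sub>R
     (of_real (r powr (p - 1) * exp (- b * r)) * ((of_real b - a) * of_real r) ^ n / fact n))"
  have fn: "f n r = (indicator {0<..} r * (r powr (p + n - 1) * exp (- b * r))) *\<^sub>R ((of_real b - a) ^ n / fact n)" for n r
  proof (cases "r > 0")
    case True
    then have "r powr (p + n - 1) = r powr (p - 1) * r ^ n"
      by (simp add: powr_add powr_diff powr_realpow)
    then show ?thesis using True
      by (simp add: f_def scaleR_conv_of_real power_mult_distrib)
  qed (simp add: f_def)
  have fnn: "norm (f n r) = (indicator {0<..} r * (r powr (p + n - 1) * exp (- b * r))) * (norm (of_real b - a) ^ n / fact n)" for n r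
    by (auto simp: fn norm_divide norm_mult norm_power indicator_def)
  have G: "Gamma (p + n) / b powr (p + n) = Gamma p * b powr (-p) * pochhammer p n / b ^ n" for n
  proof -
    have "p \<notin> \<int>\<^sub>\<le>\<^sub>0" using p by (meson nonpos_Ints_nonpos not_le)
    then have "pochhammer p n = Gamma (p + n) / Gamma p" by (rule pochhammer_Gamma)
    moreover have "Gamma p > 0" using p by (rule Gamma_real_pos)
    ultimately have "Gamma (p + n) = Gamma p * pochhammer p n" by simp
    then show ?thesis using b by (simp add: powr_add powr_minus powr_realpow field_simps)
  qed
  have I1: "has_bochner_integral lborel (f n) ((Gamma (p + n) / b powr (p + n)) *\<^sub>R ((of_real b - a) ^ n / fact n))" for n
    unfolding fn using p b by (intro has_bochner_integral_scaleR_left has_bochner_integral_Gamma_real) auto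
  have I2: "has_bochner_integral lborel (\<lambda>r. norm (f n r)) ((Gamma (p + n) / b powr (p + n)) * (norm (of_real b - a) ^ n / fact n))" for n
    unfolding fnn using p b by (intro has_bochner_integral_mult_left has_bochner_integral_Gamma_real) auto
  have gb: "(- z gchoose n) * (- y) ^ n = pochhammer z n / fact n * y ^ n" for n and y z :: complex
    by (simp add: gbinomial_pochhammer power_minus[of y])
  have gbr: "(- z gchoose n) * (- y) ^ n = pochhammer z n / fact n * y ^ n" for n and y z :: real
    by (simp add: gbinomial_pochhammer power_minus[of y])
  have "(\<lambda>n. (- complex_of_real p gchoose n) * (- c) ^ n) sums (1 + - c) powr (- of_real p)"
    using c by (intro gen_binomial_complex) simp
  then have S1: "(\<lambda>n. pochhammer (of_real p) n / fact n * c ^ n) sums (1 - c) powr (- of_real p)"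
    unfolding gb by simp
  have "(\<lambda>n. (- p gchoose n) * (- norm c) ^ n) sums (1 + - norm c) powr (- p)"
    using c by (intro gen_binomial_real) simp
  then have S2: "summable (\<lambda>n. pochhammer p n / fact n * norm c ^ n)"
    unfolding gbr by (rule sums_summable)
  have T1: "(Gamma (p + n) / b powr (p + n)) *\<^sub>R ((of_real b - a) ^ n / fact n)
      = of_real (Gamma p * b powr (-p)) * (pochhammer (of_real p) n / fact n * c ^ n)" for n
    unfolding G c_def scaleR_conv_of_real using b by (simp add: power_divide field_simps pochhammer_of_real)
  have T2: "(Gamma (p + n) / b powr (p + n)) * (norm (of_real b - a) ^ n / fact n)
      = (Gamma p * b powr (-p)) * (pochhammer p n / fact n * norm c ^ n)" for n
    unfolding G c_def norm_divide using b by (simp add: power_divide field_simps)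
  have sum_f: "(\<lambda>n. f n r) sums (indicator {0<..} r *\<^sub>R (of_real (r powr (p - 1)) * exp (- a * of_real r)))" for r
  proof -
    have "(\<lambda>n. ((of_real b - a) * of_real r) ^ n /\<^sub>R fact n) sums exp ((of_real b - a) * of_real r)"
      by (rule exp_converges)
    then have "(\<lambda>n. (indicator {0<..} r *\<^sub>R (of_real (r powr (p - 1) * exp (- b * r)))) * (((of_real b - a) * of_real r) ^ n /\<^sub>R fact n))
       sums ((indicator {0<..} r *\<^sub>R (of_real (r powr (p - 1) * exp (- b * r)))) * exp ((of_real b - a) * of_real r))"
      by (rule sums_mult)
    moreover have "complex_of_real (exp (- b * r)) * exp ((of_real b - a) * of_real r) = exp (- a * of_real r)"
      by (simp add: exp_of_real[symmetric] algebra_simps flip: exp_add)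
    then have "(indicator {0<..} r *\<^sub>R (of_real (r powr (p - 1) * exp (- b * r)))) * exp ((of_real b - a) * of_real r)
       = indicator {0<..} r *\<^sub>R (of_real (r powr (p - 1)) * exp (- a * of_real r))"
      unfolding of_real_mult by (simp only: scaleR_conv_of_real mult.assoc)
    ultimately show ?thesis
      by (simp only: f_def scaleR_conv_of_real divide_inverse mult_ac of_real_inverse of_real_fact)
  qed
  have sn: "summable (\<lambda>n. norm (f n r))" for r
  proof -
    have "summable (\<lambda>n. norm (((of_real b - a) * of_real r) ^ n /\<^sub>R fact n))"
      by (rule summable_norm_exp)
    then have "summable (\<lambda>n. norm (indicator {0<..} r *\<^sub>R (of_real (r powr (p - 1) * exp (- b * r)) :: complex)) * norm (((of_real b - a) * of_real r) ^ n /\<^sub>R fact n))"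
      by (rule summable_mult)
    then show ?thesis
      unfolding norm_mult[symmetric]
      by (simp add: f_def scaleR_conv_of_real field_simps)
  qed
  \<comment> \<open>The integrals of the norms form the real binomial series at
    \<open>norm c\<close> < 1; this justifies termwise integration.\<close>
  have sI: "summable (\<lambda>n. \<integral>r. norm (f n r) \<partial>lborel)"
    unfolding has_bochner_integral_integral_eq[OF I2] T2 by (intro summable_mult S2)
  have int: "integrable lborel (f n)" for n using I1 by (rule Bochner_Integration.integrable.intros)
  have eq: "(\<Sum>n. f n r) = indicator {0<..} r *\<^sub>R (of_real (r powr (p - 1)) * exp (- a * of_real r))" for r
    using sum_f by (rule sums_unique[symmetric])
  have "(\<lambda>n. integral\<^sup>L lborel (f n)) sums (\<integral>r. (\<Sum>n. f n r) \<partial>lborel)"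
    by (rule sums_integral[OF int _ sI]) (simp add: sn)
  moreover have "(\<lambda>n. integral\<^sup>L lborel (f n)) sums (of_real (Gamma p * b powr (-p)) * (1 - c) powr (- of_real p))"
    unfolding has_bochner_integral_integral_eq[OF I1] T1 by (intro sums_mult S1)
  ultimately have "(\<integral>r. (\<Sum>n. f n r) \<partial>lborel) = of_real (Gamma p * b powr (-p)) * (1 - c) powr (- of_real p)"
    by (rule sums_unique2)
  moreover have "complex_of_real (b powr (-p)) * (1 - c) powr (- of_real p) = a powr (- of_real p)"
  proof -
    have "a = of_real b * (1 - c)" using b by (simp add: c_def field_simps)
    then show ?thesis using b by (simp add: powr_times_real_left powr_of_real[symmetric])
  qed
  moreover have "integrable lborel (\<lambda>r. \<Sum>n. f n r)"
    by (rule integrable_suminf[OF int _ sI]) (simp add: sn)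
  ultimately show ?thesis
    unfolding eq by (simp add: has_bochner_integral_iff mult.assoc)
qed

section \<open>The Wright function as a ray integral\<close>

text \<open>
  In the usual notation for the Wright function this is \<open>\<phi>(- \<nu>, 0; - z)\<close>; the terms with
  \<open>\<nu> n\<close> a natural number vanish, because \<open>rGamma\<close> does at the poles of \<open>Gamma\<close>.
\<close>

definition wright_phi0 :: "real \<Rightarrow> real \<Rightarrow> real" where
  "wright_phi0 \<nu> z = (\<Sum>n. (- z) ^ n * rGamma (- \<nu> * real n) / fact n)"

lemma rGamma_reflection_real: "rGamma (x::real) * rGamma (1 - x) = sin (pi * x) / pi"
proof -
  have "complex_of_real (rGamma x * rGamma (1 - x)) = of_real (sin (pi * x) / pi)"
    using rGamma_reflection_complex[of "of_real x"]
    by (simp add: rGamma_complex_of_real[symmetric] sin_of_real[symmetric])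
  then show ?thesis by (simp only: of_real_eq_iff)
qed

text \<open>Splits a coefficient of the Wright series into a Gamma value, to be written as an
  integral, and a sine, to be read as an imaginary part. At natural y both sides vanish.\<close>

lemma rGamma_neg:
  assumes "y > -1"
  shows "rGamma (- y :: real) = - Gamma (1 + y) * sin (pi * y) / pi"
proof -
  have "Gamma (1 + y) > 0" using assms by (intro Gamma_real_pos) auto
  then show ?thesis
    using rGamma_reflection_real[of "- y"] by (simp add: rGamma_inverse_Gamma[of "1 + y"] field_simps)
qed

section \<open>Convergence of the Wright series\<close>

lemma set_integrable_exp_powr:
  fixes c x \<nu> :: real
  assumes c: "c > 0" and x: "x \<ge> 0" and \<nu>: "0 < \<nu>" "\<nu> < 1"
  shows "set_integrable lborel {0<..} (\<lambda>r. exp (- c * r + x * r powr \<nu>))"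
proof -
  \<comment> \<open>For r >= \<open>R\<close> the power r^(1 - \<nu>) exceeds 2 x / c, so x r^\<nu>
    is absorbed by half of the linear term; below \<open>R\<close> it is at most x R^\<nu>. The
    summand 1 keeps the base positive also for x = 0.\<close>
  define R where "R = (2 * x / c + 1) powr (1 / (1 - \<nu>))"
  have bound: "x * r powr \<nu> \<le> c / 2 * r + x * R powr \<nu>" if r: "r > 0" for r
  proof (cases "r \<le> R")
    case True
    have "x * r powr \<nu> \<le> x * R powr \<nu>"
      using True r x \<nu> by (intro mult_left_mono powr_mono2) auto
    then show ?thesis using c r by (simp add: add_increasing)
  next
    case False
    have pos: "2 * x / c + 1 > 0" using x c by (simp add: add_nonneg_pos)
    have "2 * x / c + 1 = R powr (1 - \<nu>)"
      using pos \<nu> by (simp add: R_def powr_powr)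
    also have "\<dots> \<le> r powr (1 - \<nu>)"
      using False \<nu> by (intro powr_mono2) (auto simp: R_def)
    finally have "2 * x / c \<le> r powr (1 - \<nu>)" by simp
    then have "x \<le> c / 2 * r powr (1 - \<nu>)" using c by (simp add: field_simps)
    then have "x * r powr \<nu> \<le> c / 2 * r powr (1 - \<nu>) * r powr \<nu>"
      by (intro mult_right_mono) auto
    also have "\<dots> = c / 2 * r" using r by (simp add: mult.assoc flip: powr_add)
    finally show ?thesis using x by (simp add: add_increasing2)
  qed
  have "integrable lborel (\<lambda>r. indicator {0<..} r * (r powr (1 - 1) * exp (- (c / 2) * r)))"
    using has_bochner_integral_Gamma_real[of 1 "c / 2"] c by (simp add: has_bochner_integral_iff)
  then have "integrable lborel (\<lambda>r. exp (x * R powr \<nu>) * (indicator {0<..} r * (r powr (1 - 1) * exp (- (c / 2) * r))))"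
    by (rule integrable_mult_right)
  then show ?thesis
    unfolding set_integrable_def
  proof (rule Bochner_Integration.integrable_bound)
    show "AE r in lborel. norm (indicat_real {0<..} r *\<^sub>R exp (- c * r + x * r powr \<nu>))
        \<le> norm (exp (x * R powr \<nu>) * (indicator {0<..} r * (r powr (1 - 1) * exp (- (c / 2) * r))))"
    proof (rule AE_I2)
      fix r :: real
      have "- c * r + x * r powr \<nu> \<le> x * R powr \<nu> + - (c / 2) * r" if "r > 0"
        using bound[OF that] by (simp add: field_simps)
      then show "norm (indicat_real {0<..} r *\<^sub>R exp (- c * r + x * r powr \<nu>))
        \<le> norm (exp (x * R powr \<nu>) * (indicator {0<..} r * (r powr (1 - 1) * exp (- (c / 2) * r))))"
        by (cases "r > 0") (auto simp: exp_add[symmetric])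
    qed
  qed measurable
qed

text \<open>The n-th term is the integral of e^(- c r) (x r^\<nu>)^n / n!. Hence partial sums are
  integrals of partial sums of an exponential series and are bounded by the integral of exp (- c r +
  x r^\<nu>); no asymptotics of Gamma enter.\<close>

lemma summable_Gamma_stretch:
  fixes c x \<nu> :: real
  assumes c: "c > 0" and x: "x \<ge> 0" and \<nu>: "0 < \<nu>" "\<nu> < 1"
  shows "summable (\<lambda>n. x ^ n / fact n * (Gamma (1 + \<nu> * real n) / c powr (1 + \<nu> * real n)))"
proof (rule summableI_nonneg_bounded)
  let ?m = "\<lambda>n. x ^ n / fact n * (Gamma (1 + \<nu> * real n) / c powr (1 + \<nu> * real n))"
  let ?g = "\<lambda>n r. x ^ n / fact n * (indicator {0<..} r * (r powr (1 + \<nu> * real n - 1) * exp (- c * r)))"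
  let ?B = "\<integral>r. indicat_real {0<..} r *\<^sub>R exp (- c * r + x * r powr \<nu>) \<partial>lborel"
  have hb: "has_bochner_integral lborel (?g n) (?m n)" for n
    using c \<nu> by (intro has_bochner_integral_mult_right has_bochner_integral_Gamma_real) (auto intro: add_pos_nonneg)
  show "0 \<le> ?m n" for n
    using x \<nu> by (intro mult_nonneg_nonneg divide_nonneg_nonneg less_imp_le[OF Gamma_real_pos]) (auto intro: add_pos_nonneg)
  show "(\<Sum>n<N. ?m n) \<le> ?B" for N
  proof -
    have hs: "has_bochner_integral lborel (\<lambda>r. \<Sum>n<N. ?g n r) (\<Sum>n<N. ?m n)"
      by (intro has_bochner_integral_sum hb)
    have "(\<Sum>n<N. ?m n) = (\<integral>r. (\<Sum>n<N. ?g n r) \<partial>lborel)"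
      using hs by (simp add: has_bochner_integral_iff)
    also have "\<dots> \<le> ?B"
    proof (rule integral_mono)
      show "integrable lborel (\<lambda>r. \<Sum>n<N. ?g n r)" using hs by (simp add: has_bochner_integral_iff)
      show "integrable lborel (\<lambda>r. indicat_real {0<..} r *\<^sub>R exp (- c * r + x * r powr \<nu>))"
        using set_integrable_exp_powr[OF assms] by (simp add: set_integrable_def)
      show "(\<Sum>n<N. ?g n r) \<le> indicat_real {0<..} r *\<^sub>R exp (- c * r + x * r powr \<nu>)" for r
      proof (cases "r > 0")
        case True
        have "(\<Sum>n<N. ?g n r) = exp (- c * r) * (\<Sum>n<N. (x * r powr \<nu>) ^ n /\<^sub>R fact n)"
          using True by (simp add: sum_distrib_left power_mult_distrib powr_powr[symmetric] powr_realpow divide_inverse mult_ac)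
        also have "(\<Sum>n<N. (x * r powr \<nu>) ^ n /\<^sub>R fact n) \<le> exp (x * r powr \<nu>)"
          unfolding exp_def using x by (intro sum_le_suminf summable_exp_generic) auto
        finally show ?thesis using True by (simp add: exp_diff exp_minus divide_inverse mult_ac)
      qed simp
    qed
    finally show ?thesis .
  qed
qed

lemma summable_wright_phi0:
  fixes z \<nu> :: real
  assumes \<nu>: "0 < \<nu>" "\<nu> < 1"
  shows "summable (\<lambda>n. norm ((- z) ^ n * rGamma (- \<nu> * real n) / fact n))"
proof (rule summable_comparison_test')
  show "summable (\<lambda>n. \<bar>z\<bar> ^ n / fact n * (Gamma (1 + \<nu> * real n) / 1 powr (1 + \<nu> * real n)))"
    by (rule summable_Gamma_stretch) (use \<nu> in auto)
  show "norm (norm ((- z) ^ n * rGamma (- \<nu> * real n) / fact n)) \<le> \<bar>z\<bar> ^ n / fact n * (Gamma (1 + \<nu> * real n) / 1 powr (1 + \<nu> * real n))" for n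
  proof -
    have G: "Gamma (1 + \<nu> * real n) > 0" using \<nu> by (intro Gamma_real_pos) (auto intro: add_pos_nonneg)
    have "\<bar>sin (pi * (\<nu> * real n))\<bar> \<le> pi"
      using pi_gt3 abs_sin_le_one[of "pi * (\<nu> * real n)"] by linarith
    then have "\<bar>sin (pi * (\<nu> * real n))\<bar> / pi \<le> 1" by simp
    have "\<bar>rGamma (- (\<nu> * real n))\<bar> = Gamma (1 + \<nu> * real n) * (\<bar>sin (pi * (\<nu> * real n))\<bar> / pi)"
      using G \<nu> by (subst rGamma_neg) (auto simp: abs_mult intro: less_le_trans[of _ 0])
    also have "\<dots> \<le> Gamma (1 + \<nu> * real n) * 1"
      using G \<open>_ \<le> 1\<close> by (intro mult_left_mono) auto
    finally have "\<bar>rGamma (- (\<nu> * real n))\<bar> \<le> Gamma (1 + \<nu> * real n)" by simp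
    then show ?thesis
      by (simp add: abs_mult power_abs divide_right_mono mult_left_mono)
  qed
qed

text \<open>Expanding the second exponential in powers of x leaves Gamma integrals of scale - t cis
  \<phi>. The n-th one is a real number times cis (pi + pi \<nu> n), in which \<phi> has cancelled,
  and its imaginary part is the sine from the reflection formula.\<close>

lemma wright_phi0_ray_integral:
  fixes \<nu> \<phi> x t :: real
  assumes \<nu>: "0 < \<nu>" "\<nu> < 1" and \<phi>: "pi / 2 < \<phi>" "\<phi> < pi" and x: "x \<ge> 0" and t: "t > 0"
  defines "h \<equiv> \<lambda>r. cis \<phi> * exp (of_real (t * r) * cis \<phi>) * exp (- of_real (x * r powr \<nu>) * cis (\<nu> * \<phi>))"
  shows "set_integrable lborel {0<..} h"
    and "Im (LBINT r:{0<..}. h r) = pi / t * wright_phi0 \<nu> (x * t powr - \<nu>)"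
proof -
  have cos_neg: "cos \<phi> < 0"
    using \<phi> cos_lt_zero_pi[of \<phi>] pi_gt_zero by linarith
  define a where "a = - of_real t * cis \<phi>"
  have a: "Re a > 0" using t cos_neg by (simp add: a_def mult_pos_neg)
  have a_eq: "a = of_real t * cis (\<phi> - pi)"
    by (simp add: a_def complex_eq_iff cos_diff sin_diff)
  have a0: "a \<noteq> 0" using a by auto
  \<comment> \<open>Since \<phi> - pi lies between - pi/2 and 0, this is the principal logarithm,
    the one that \<open>powr\<close> uses.\<close>
  have Ln_a: "Ln a = Complex (ln t) (\<phi> - pi)"
  proof (rule Ln_unique)
    show "exp (Complex (ln t) (\<phi> - pi)) = a"
      using t by (simp add: exp_eq_polar a_eq)
  qed (use \<phi> pi_gt_zero in auto)
  define p where "p = (\<lambda>n::nat. 1 + \<nu> * real n)"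
  have p: "p n > 0" for n using \<nu> by (simp add: p_def add_pos_nonneg)
  define d where "d = (\<lambda>n::nat. cis \<phi> * ((- of_real x * cis (\<nu> * \<phi>)) ^ n / fact n))"
  define f where "f = (\<lambda>n r. d n * (indicator {0<..} r *\<^sub>R (of_real (r powr (p n - 1)) * exp (- a * of_real r))))"
  define J where "J = (\<lambda>n. d n * (of_real (Gamma (p n)) * a powr (- of_real (p n))))"
  have I1: "has_bochner_integral lborel (f n) (J n)" for n
    unfolding f_def J_def using a p by (intro has_bochner_integral_mult_right has_bochner_integral_Gamma_complex)
  have fnn: "norm (f n r) = x ^ n / fact n * (indicator {0<..} r * (r powr (p n - 1) * exp (- Re a * r)))" for n r
    using x by (simp add: f_def d_def norm_mult norm_divide norm_power)
  have I2: "has_bochner_integral lborel (\<lambda>r. norm (f n r)) (x ^ n / fact n * (Gamma (p n) / Re a powr p n))" for n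
    unfolding fnn using a p by (intro has_bochner_integral_mult_right has_bochner_integral_Gamma_real)
  have tm: "f n r = (indicator {0<..} r *\<^sub>R (cis \<phi> * exp (of_real (t * r) * cis \<phi>)))
        * ((- of_real (x * r powr \<nu>) * cis (\<nu> * \<phi>)) ^ n /\<^sub>R fact n)" for n r
  proof (cases "r > 0")
    case True
    have "r powr (p n - 1) = (r powr \<nu>) ^ n"
      using True by (simp add: p_def powr_powr[symmetric] powr_realpow)
    then show ?thesis using True
      by (simp add: f_def d_def a_def power_mult_distrib scaleR_conv_of_real divide_inverse mult_ac)
        (simp add: power_minus[of "of_real x * _"] power_minus[of "_ * cis _"] power_minus[of "of_real x"] power_mult_distrib mult_ac)
  qed (simp add: f_def)
  have sum_f: "(\<lambda>n. f n r) sums (indicator {0<..} r *\<^sub>R h r)" for r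
  proof -
    have "(\<lambda>n. f n r) sums ((indicator {0<..} r *\<^sub>R (cis \<phi> * exp (of_real (t * r) * cis \<phi>)))
        * exp (- of_real (x * r powr \<nu>) * cis (\<nu> * \<phi>)))"
      unfolding tm by (intro sums_mult exp_converges)
    then show ?thesis by (simp add: h_def)
  qed
  have sn: "summable (\<lambda>n. norm (f n r))" for r
    unfolding tm norm_mult by (intro summable_mult summable_norm_exp)
  \<comment> \<open>|exp (- a r)| = exp (- Re a r), so the integrals of the norms are the series of
    \<open>summable_Gamma_stretch\<close> with c = \<open>Re a\<close>.\<close>
  have sI: "summable (\<lambda>n. \<integral>r. norm (f n r) \<partial>lborel)"
    unfolding has_bochner_integral_integral_eq[OF I2] p_def
    using a x \<nu> by (intro summable_Gamma_stretch)
  have int: "integrable lborel (f n)" for n using I1 by (rule Bochner_Integration.integrable.intros)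
  have eq: "(\<Sum>n. f n r) = indicator {0<..} r *\<^sub>R h r" for r
    using sum_f by (rule sums_unique[symmetric])
  have "integrable lborel (\<lambda>r. \<Sum>n. f n r)"
    by (rule integrable_suminf[OF int _ sI]) (simp add: sn)
  then show "set_integrable lborel {0<..} h" unfolding eq set_integrable_def .
  have "(\<lambda>n. integral\<^sup>L lborel (f n)) sums (\<integral>r. (\<Sum>n. f n r) \<partial>lborel)"
    by (rule sums_integral[OF int _ sI]) (simp add: sn)
  then have "J sums (LBINT r:{0<..}. h r)"
    unfolding eq has_bochner_integral_integral_eq[OF I1] set_lebesgue_integral_def .
  then have S1: "(\<lambda>n. Im (J n)) sums Im (LBINT r:{0<..}. h r)"
    by (rule sums_Im)
  have ImJ: "Im (J n) = pi / t * ((- (x * t powr - \<nu>)) ^ n * rGamma (- \<nu> * real n) / fact n)" for n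
  proof -
    have "a powr (- of_real (p n)) = exp (- of_real (p n) * Ln a)"
      using a0 by (simp add: powr_def)
    also have "- of_real (p n) * Ln a = Complex (- p n * ln t) (p n * (pi - \<phi>))"
      unfolding Ln_a by (simp add: complex_eq_iff algebra_simps)
    also have "exp (Complex (- p n * ln t) (p n * (pi - \<phi>))) = of_real (t powr - p n) * cis (p n * (pi - \<phi>))"
      using t by (simp add: exp_eq_polar powr_def)
    finally have ap: "a powr (- of_real (p n)) = of_real (t powr - p n) * cis (p n * (pi - \<phi>))" .
    have "J n = of_real ((- x) ^ n / fact n * Gamma (p n) * t powr - p n) * (cis \<phi> * cis (\<nu> * \<phi>) ^ n * cis (p n * (pi - \<phi>)))"
    proof -
      have 1: "(- of_real x * cis (\<nu> * \<phi>)) ^ n = of_real ((- x) ^ n) * cis (\<nu> * \<phi>) ^ n"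
        by (simp only: power_mult_distrib of_real_power of_real_minus)
      show ?thesis unfolding J_def d_def ap 1 by simp
    qed
    \<comment> \<open>The angles add up as \<phi> + n \<nu> \<phi> + (1 + \<nu> n) (pi - \<phi>) =
      pi + pi \<nu> n.\<close>
    also have "cis \<phi> * cis (\<nu> * \<phi>) ^ n * cis (p n * (pi - \<phi>)) = cis (pi + pi * (\<nu> * real n))"
      unfolding Complex.DeMoivre cis_mult by (simp add: p_def algebra_simps)
    finally have J: "J n = of_real ((- x) ^ n / fact n * Gamma (p n) * t powr - p n) * cis (pi + pi * (\<nu> * real n))" .
    have Im_mult: "Im (of_real u * v) = u * Im v" for u v by simp
    have "Im (J n) = (- x) ^ n / fact n * Gamma (p n) * t powr - p n * - sin (pi * (\<nu> * real n))"
      unfolding J Im_mult by (simp add: sin_add)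
    moreover have "- Gamma (p n) * sin (pi * (\<nu> * real n)) = pi * rGamma (- \<nu> * real n)"
      using rGamma_neg[of "\<nu> * real n"] \<nu> by (simp add: p_def less_le_trans[of "-1" 0])
    moreover have "t powr - p n = (t powr - \<nu>) ^ n / t"
    proof -
      have "t powr - p n = t powr (- 1 + - \<nu> * real n)" by (simp add: p_def)
      also have "\<dots> = t powr (- 1) * (t powr - \<nu>) powr real n"
        by (simp only: powr_add powr_powr)
      finally have "t powr - p n = t powr (- 1) * (t powr - \<nu>) powr real n" .
      then show ?thesis using t by (simp add: powr_realpow powr_minus divide_inverse)
    qed
    moreover have "(- x) ^ n / fact n * G * (T / t) * - s = - G * s * ((- x) ^ n * T / fact n / t)" for G T s
      by simp
    ultimately have "Im (J n) = pi * rGamma (- \<nu> * real n) * ((- x) ^ n * (t powr - \<nu>) ^ n / fact n / t)"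
      by metis
    also have "(- x) ^ n * (t powr - \<nu>) ^ n = (- (x * t powr - \<nu>)) ^ n"
      by (simp flip: power_mult_distrib)
    finally show ?thesis by (simp add: mult_ac)
  qed
  have "(\<lambda>n. Im (J n)) sums (pi / t * wright_phi0 \<nu> (x * t powr - \<nu>))"
    unfolding ImJ wright_phi0_def
    by (intro sums_mult summable_sums summable_norm_cancel[OF summable_wright_phi0] \<nu>)
  with S1 show "Im (LBINT r:{0<..}. h r) = pi / t * wright_phi0 \<nu> (x * t powr - \<nu>)"
    by (rule sums_unique2)
qed

section \<open>The contour integral\<close>

lemma residue_deriv_eq_0:
  assumes "open S" "z \<in> S" "f holomorphic_on S - {z}"
  shows "residue (deriv f) z = 0"
proof -
  obtain r where r: "r > 0" "cball z r \<subseteq> S"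
    using assms open_contains_cball by blast
  have opn: "open (S - {z})" using assms by (intro open_Diff) auto
  have "(deriv f has_contour_integral 2 * pi * \<i> * residue (deriv f) z) (circlepath z r)"
    using assms r opn by (intro base_residue[of S] holomorphic_deriv) auto
  \<comment> \<open>\<open>f\<close> is a single-valued primitive on the punctured set, so the
    integral round the circle vanishes.\<close>
  moreover have "(deriv f has_contour_integral 0) (circlepath z r)"
  proof (rule Cauchy_theorem_primitive[of "S - {z}" f])
    show "(f has_field_derivative deriv f w) (at w within S - {z})" if "w \<in> S - {z}" for w
      using holomorphic_derivI[OF assms(3) opn that] by (rule has_field_derivative_at_within)
    show "path_image (circlepath z r) \<subseteq> S - {z}"
      using r by (auto simp: dist_norm)
  qed auto
  ultimately have "2 * pi * \<i> * residue (deriv f) z = 0"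
    by (rule has_contour_integral_unique)
  then show ?thesis by simp
qed

lemma exp_neq_1_strip:
  fixes w :: complex
  assumes "\<bar>Im w\<bar> < 2 * pi" "w \<noteq> 0"
  shows "exp w \<noteq> 1"
proof
  assume "exp w = 1"
  then obtain n :: int where n: "Re w = 0" "Im w = of_int (2 * n) * pi"
    unfolding exp_eq_1 by blast
  then have "\<bar>of_int n\<bar> * (2 * pi) < 1 * (2 * pi)"
    using assms by (simp add: abs_mult mult_ac)
  then have "\<bar>real_of_int n\<bar> < 1" by (subst (asm) mult_less_cancel_right) auto
  then have "n = 0" by linarith
  with n assms show False by (simp add: complex_eq_iff)
qed

text \<open>The hypothesis says that \<open>A (Suc j)\<close> is the derivative of
  \<open>A j\<close> with respect to s = exp w, and exp w dw = ds. So this is Cauchy's formula for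
  the k-th derivative at s = 1, pulled back to w = 0. The induction leaves j free, because lowering
  the order of the pole raises j.\<close>

lemma residue_exp_pole:
  fixes A :: "nat \<Rightarrow> complex \<Rightarrow> complex"
  assumes A: "\<And>j w. (A j has_field_derivative A (Suc j) w * exp w) (at w)"
  shows "residue (\<lambda>w. A j w * exp w / (1 - exp w) ^ Suc k) 0 = - ((-1) ^ k / fact k) * A (j + k) 0"
proof -
  have ne: "exp w \<noteq> 1" if "w \<in> ball 0 1 - {0}" for w :: complex
  proof -
    have "\<bar>Im w\<bar> < 2 * pi"
      using that abs_Im_le_cmod[of w] pi_gt3 by auto
    then show ?thesis using that exp_neq_1_strip by auto
  qed
  have hol [holomorphic_intros]: "A j holomorphic_on X" for j X
    using A unfolding holomorphic_on_def field_differentiable_def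
    by (blast intro: has_field_derivative_at_within)
  show ?thesis
  proof (induction k arbitrary: j)
    case 0
    have "((\<lambda>w. (exp w - 1) / w) \<longlongrightarrow> (1::complex)) (at 0)"
      using DERIV_exp[of "0::complex"] by (simp add: DERIV_def)
    then have "((\<lambda>w. - (A j w * exp w / ((exp w - 1) / w))) \<longlongrightarrow> - (A j 0 * exp 0 / 1)) (at 0)"
      using DERIV_isCont[OF A[of j 0]] by (intro tendsto_intros) (auto simp: isCont_def)
    moreover have "- (A j w * exp w / ((exp w - 1) / w)) = A j w * exp w / (1 - exp w) ^ Suc 0 * (w - 0)" for w
      using minus_divide_right[of "A j w * exp w * w" "exp w - 1"] by simp
    ultimately have "((\<lambda>w. A j w * exp w / (1 - exp w) ^ Suc 0 * (w - 0)) \<longlongrightarrow> - A j 0) (at 0)"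
      by simp
    then show ?case
      by (subst residue_simple'[of "ball 0 1" 0]) (auto intro!: holomorphic_intros simp: ne)
  next
    case (Suc k)
    \<comment> \<open>The derivative of \<open>F\<close> has residue 0, which lowers the order of the pole by one.\<close>
    define F where "F = (\<lambda>w. A j w / (1 - exp w) ^ Suc k)"
    let ?G = "\<lambda>w. A (Suc j) w * exp w / (1 - exp w) ^ Suc k"
    let ?H = "\<lambda>w. A j w * exp w / (1 - exp w) ^ Suc (Suc k)"
    have "residue (deriv F) 0 = 0"
      by (rule residue_deriv_eq_0[of "ball 0 1"]) (auto intro!: holomorphic_intros simp: F_def ne)
    moreover have "deriv F w = ?G w + of_nat (Suc k) * ?H w" if w: "w \<in> ball 0 1 - {0}" for w
    proof -
      have "1 - exp w \<noteq> 0" using ne[OF w] by simp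
      moreover have "((\<lambda>w. (1 - exp w) ^ Suc k) has_field_derivative
          (1 + of_nat k) * (- exp w * (1 - exp w) ^ k)) (at w)"
        by (rule DERIV_power_Suc) (auto intro!: derivative_eq_intros)
      ultimately have "(F has_field_derivative (A (Suc j) w * exp w * (1 - exp w) ^ Suc k -
          A j w * ((1 + of_nat k) * (- exp w * (1 - exp w) ^ k))) / ((1 - exp w) ^ Suc k * (1 - exp w) ^ Suc k)) (at w)"
        unfolding F_def by (intro DERIV_divide A) auto
      also have "(A (Suc j) w * exp w * (1 - exp w) ^ Suc k -
          A j w * ((1 + of_nat k) * (- exp w * (1 - exp w) ^ k))) / ((1 - exp w) ^ Suc k * (1 - exp w) ^ Suc k)
          = ?G w + of_nat (Suc k) * ?H w"
      proof -
        have "(a * (D * P) - b * ((1 + n) * (- e * P))) / (D * P * (D * P)) = a / (D * P) + (1 + n) * (b * e / (D * (D * P)))"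
          if "D \<noteq> 0" "P \<noteq> 0" for a b n e D P :: complex
          using that by (simp add: field_simps)
        from this[of "1 - exp w" "(1 - exp w) ^ k" "A (Suc j) w * exp w" "A j w" "of_nat k" "exp w"]
        show ?thesis using \<open>1 - exp w \<noteq> 0\<close> by simp
      qed
      finally have "(F has_field_derivative (?G w + of_nat (Suc k) * ?H w)) (at w)" .
      then show ?thesis by (rule DERIV_imp_deriv)
    qed
    then have "residue (deriv F) 0 = residue (\<lambda>w. ?G w + of_nat (Suc k) * ?H w) 0"
      by (intro residue_cong) (auto simp: eventually_at_topological intro!: exI[of _ "ball 0 1"])
    moreover have "residue (\<lambda>w. ?G w + of_nat (Suc k) * ?H w) 0
       = residue ?G 0 + residue (\<lambda>w. of_nat (Suc k) * ?H w) 0"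
      by (rule residue_add[of "ball 0 1"]) (auto intro!: holomorphic_intros simp: ne)
    moreover have "residue (\<lambda>w. of_nat (Suc k) * ?H w) 0 = of_nat (Suc k) * residue ?H 0"
      by (rule residue_lmul[of "ball 0 1"]) (auto intro!: holomorphic_intros simp: ne)
    ultimately have "residue ?G 0 + of_nat (Suc k) * residue ?H 0 = 0"
      by argo
    then have "of_nat (Suc k) * residue ?H 0 = - residue ?G 0"
      unfolding add_eq_0_iff .
    also have "\<dots> = (- 1) ^ k / fact k * A (Suc j + k) 0" unfolding Suc.IH by simp
    finally have *: "of_nat (Suc k) * residue ?H 0 = (- 1) ^ k / fact k * A (Suc j + k) 0" .
    have "residue ?H 0 = of_nat (Suc k) * residue ?H 0 / of_nat (Suc k)"
      by (rule nonzero_mult_div_cancel_left[symmetric]) (simp del: of_nat_Suc)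
    also have "\<dots> = - ((-1) ^ Suc k / fact (Suc k)) * A (j + Suc k) 0"
      unfolding * by (simp add: mult.commute)
    finally show ?case .
  qed
qed

section \<open>Derivatives of exp (- x s^nu) and the series 1Psi1\<close>

lemma summable_of_nat_mult_power_series:
  fixes c :: "nat \<Rightarrow> 'a :: {real_normed_field, banach}"
  assumes "\<And>y. summable (\<lambda>n. c n * y ^ n)"
  shows "summable (\<lambda>n. of_nat n * c n * y ^ n)"
proof -
  have "summable (\<lambda>n. y * (diffs c n * y ^ n))"
    using termdiff_converges_all[OF assms] by (rule summable_mult)
  then show ?thesis
    by (subst summable_Suc_iff[symmetric]) (simp add: diffs_def mult_ac)
qed

text \<open>
  In the coordinate \<open>s = exp w\<close> the functions \<open>A j\<close> are the successive derivatives of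
  \<open>exp (- x s powr \<nu>)\<close>; this coordinate makes them entire.
\<close>

lemma wright_derivatives:
  fixes \<nu> x :: real
  defines "c \<equiv> \<lambda>j n. (\<Prod>i<j. \<nu> * real n - real i) * (- x) ^ n / fact n"
  defines "A \<equiv> \<lambda>j w. exp (- of_nat j * w) * (\<Sum>n. of_real (c j n) * exp (of_real \<nu> * w) ^ n :: complex)"
  shows "(A j has_field_derivative A (Suc j) w * exp w) (at w)"
    and "A 0 w = exp (- of_real x * exp (of_real \<nu> * w))"
    and "A k 0 = (-1) ^ k * of_real (wright_Psi11 (- \<nu>) k (- x))"
proof -
  \<comment> \<open>In terms of s the function \<open>A j\<close> is the sum of c j n s^(\<nu> n -
    j), so each differentiation contributes the factor \<nu> n - j.\<close>
  have c_Suc: "c (Suc j) n = (\<nu> * real n - real j) * c j n" for j n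
    by (simp add: c_def)
  have sm: "summable (\<lambda>n. of_real (c j n) * y ^ n :: complex)" for j y
  proof (induction j arbitrary: y)
    case 0
    have "summable (\<lambda>n. (- of_real x * y) ^ n /\<^sub>R fact n)" by (rule summable_exp_generic)
    then show ?case
      by (simp add: c_def power_mult_distrib scaleR_conv_of_real divide_inverse mult_ac flip: power_mult_distrib)
  next
    case (Suc j)
    have "summable (\<lambda>n. of_real \<nu> * (of_nat n * of_real (c j n) * y ^ n) - of_nat j * (of_real (c j n) * y ^ n))"
      by (intro summable_diff summable_mult summable_of_nat_mult_power_series Suc.IH)
    then show ?case by (simp add: c_Suc algebra_simps)
  qed
  let ?P = "\<lambda>j y. \<Sum>n. of_real (c j n) * y ^ n :: complex"
  have P': "(?P j has_field_derivative (\<Sum>n. diffs (\<lambda>n. of_real (c j n)) n * y ^ n)) (at y)" for j y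
    by (rule termdiffs_strong_converges_everywhere) (rule sm)
  have P'': "y * (\<Sum>n. diffs (\<lambda>n. of_real (c j n)) n * y ^ n) = (\<Sum>n. of_nat n * of_real (c j n) * y ^ n)" for j and y :: complex
  proof -
    have "(\<lambda>n. of_nat n * of_real (c j n) * y ^ n) sums (y * (\<Sum>n. diffs (\<lambda>n. of_real (c j n)) n * y ^ n))"
    proof -
      have "(\<lambda>n. y * (diffs (\<lambda>n. of_real (c j n)) n * y ^ n)) sums (y * (\<Sum>n. diffs (\<lambda>n. of_real (c j n)) n * y ^ n))"
        by (intro sums_mult summable_sums termdiff_converges_all sm)
      then have "(\<lambda>n. of_nat (Suc n) * of_real (c j (Suc n)) * y ^ Suc n) sums (y * (\<Sum>n. diffs (\<lambda>n. of_real (c j n)) n * y ^ n))"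
        by (simp add: diffs_def mult_ac)
      then show ?thesis by (subst (asm) sums_Suc_iff) simp
    qed
    then show ?thesis by (rule sums_unique)
  qed
  show "(A j has_field_derivative A (Suc j) w * exp w) (at w)"
  proof -
    let ?y = "exp (of_real \<nu> * w)"
    let ?D = "\<Sum>n. diffs (\<lambda>n. of_real (c j n)) n * ?y ^ n"
    have 1: "((\<lambda>w. ?P j (exp (of_real \<nu> * w))) has_field_derivative ?D * (?y * of_real \<nu>)) (at w)"
      by (rule DERIV_chain2[OF P']) (auto intro!: derivative_eq_intros)
    have "(A j has_field_derivative (exp (- of_nat j * w) * (?D * (?y * of_real \<nu>))
          + (- of_nat j * exp (- of_nat j * w)) * ?P j ?y)) (at w)"
      unfolding A_def by (rule derivative_eq_intros 1 refl | simp)+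
    also have "exp (- of_nat j * w) * (?D * (?y * of_real \<nu>)) + (- of_nat j * exp (- of_nat j * w)) * ?P j ?y
       = exp (- of_nat j * w) * (of_real \<nu> * (?y * ?D) - of_nat j * ?P j ?y)"
      by (simp add: algebra_simps)
    \<comment> \<open>The operator y d/dy multiplies the n-th coefficient by n; together with - j
      this is the factor \<nu> n - j of \<open>c_Suc\<close>.\<close>
    also have "of_real \<nu> * (?y * ?D) - of_nat j * ?P j ?y = ?P (Suc j) ?y"
      unfolding P''
      by (subst (1 2) suminf_mult[symmetric], (intro sm summable_of_nat_mult_power_series)+,
          subst suminf_diff, (intro summable_mult sm summable_of_nat_mult_power_series)+)
         (simp add: c_Suc algebra_simps)
    also have "exp (- of_nat j * w) * ?P (Suc j) ?y = A (Suc j) w * exp w"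
      by (simp add: A_def algebra_simps exp_diff exp_add exp_minus field_simps)
    finally show ?thesis .
  qed
  show "A 0 w = exp (- of_real x * exp (of_real \<nu> * w))"
    by (simp add: A_def c_def exp_def power_mult_distrib scaleR_conv_of_real divide_inverse mult_ac flip: power_mult_distrib)
  \<comment> \<open>At s = 1 all powers of s are 1, and the falling product of \<nu> n is (- 1)^k
    times the rising product of - \<nu> n.\<close>
  have poch: "pochhammer (- \<nu> * real n) k * (- x) ^ n / fact n = (-1) ^ k * c k n" for n
  proof -
    have "pochhammer (- \<nu> * real n) k = (\<Prod>i<k. (-1) * (\<nu> * real n - real i))"
      unfolding pochhammer_prod atLeast0LessThan by (intro prod.cong) auto
    also have "\<dots> = (-1) ^ k * (\<Prod>i<k. \<nu> * real n - real i)"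
      unfolding prod.distrib by simp
    finally show ?thesis by (simp add: c_def)
  qed
  have smr: "summable (c k)"
    using sm[of k 1] by (simp add: summable_complex_of_real)
  show "A k 0 = (-1) ^ k * of_real (wright_Psi11 (- \<nu>) k (- x))"
    unfolding wright_Psi11_def poch suminf_mult[OF smr]
    by (simp add: A_def suminf_of_real[OF smr] flip: mult.assoc power_mult_distrib)
qed

text \<open>The sign (- 1)^k of Cauchy's formula cancels the one between the k-th derivative and the
  Wright series.\<close>

lemma residue_wright:
  "residue (\<lambda>w. exp (- of_real x * exp (of_real \<nu> * w)) * exp w / (1 - exp w) ^ Suc k) 0
     = - of_real (wright_Psi11 (- \<nu>) k (- x) / fact k)"
proof -
  define A where "A = (\<lambda>j w. exp (- of_nat j * w) * (\<Sum>n. of_real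
     ((\<Prod>i<j. \<nu> * real n - real i) * (- x) ^ n / fact n) * exp (of_real \<nu> * w) ^ n :: complex))"
  have "residue (\<lambda>w. A 0 w * exp w / (1 - exp w) ^ Suc k) 0 = - ((-1) ^ k / fact k) * A (0 + k) 0"
    by (rule residue_exp_pole, unfold A_def, rule wright_derivatives)
  moreover have "A 0 = (\<lambda>w. exp (- of_real x * exp (of_real \<nu> * w)))"
    unfolding A_def by (intro ext wright_derivatives)
  moreover have "A k 0 = (-1) ^ k * of_real (wright_Psi11 (- \<nu>) k (- x))"
    unfolding A_def by (rule wright_derivatives)
  ultimately show ?thesis by (simp flip: power_mult_distrib mult.assoc)
qed

section \<open>Rectangles around the pole\<close>

lemma contour_integral_linepath_same_Im:
  assumes "a < b"
  shows "contour_integral (linepath (Complex a c) (Complex b c)) f = integral {a..b} (\<lambda>u. f (Complex u c))"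
proof -
  have lp: "linepath (Complex a c) (Complex b c) t = linepath (of_real a) (of_real b) t + \<i> * of_real c" for t
    by (simp add: linepath_def complex_eq_iff algebra_simps)
  have df: "Complex b c - Complex a c = of_real b - of_real a" by (simp add: complex_eq_iff)
  have "contour_integral (linepath (Complex a c) (Complex b c)) f
      = contour_integral (linepath (of_real a) (of_real b)) (\<lambda>w. f (w + \<i> * of_real c))"
    unfolding contour_integral_integral vector_derivative_linepath_at lp df ..
  also have "\<dots> = integral {a..b} (\<lambda>u. f (of_real u + \<i> * of_real c))"
    using assms by (subst contour_integral_linepath_Reals_eq) auto
  also have "(\<lambda>u. f (of_real u + \<i> * of_real c)) = (\<lambda>u. f (Complex u c))"
    by (simp add: Complex_eq)
  finally show ?thesis .
qed

text \<open>Re (exp (\<nu> w)) = exp (\<nu> Re w) cos (\<nu> Im w) is nonnegative under the angle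
  bound. If \<nu> \<phi> <= pi/2, this covers the whole strip between the lines Im w = \<phi> and Im
  w = - \<phi>.\<close>

lemma norm_exp_wright_le_1:
  assumes "x \<ge> 0" "\<bar>\<nu> * Im w\<bar> \<le> pi / 2"
  shows "norm (exp (- of_real x * exp (of_real \<nu> * w))) \<le> 1"
proof -
  have "cos (\<nu> * Im w) \<ge> 0" using assms by (intro cos_ge_zero) auto
  then show ?thesis using assms by (simp add: Re_exp)
qed

text \<open>The residue theorem is applied to the rectangle with corners at real parts n and - n and
  imaginary parts \<phi> and - \<phi>. On the left edge the integrand is of order e^(- n); on the
  right edge it is of order e^(- k n), which is where k > 0 enters.\<close>

lemma wright_line_integral:
  fixes \<nu> \<phi> x :: real and k :: nat
  assumes \<nu>: "\<nu> \<ge> 0" and \<phi>: "0 < \<phi>" "\<phi> < pi" "\<nu> * \<phi> \<le> pi / 2" and x: "x \<ge> 0" and k: "k > 0"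
  defines "q \<equiv> \<lambda>w. exp (- of_real x * exp (of_real \<nu> * w)) * exp w / (1 - exp w) ^ Suc k"
  shows "(\<lambda>n. Im (integral {- real n..real n} (\<lambda>u. q (Complex u \<phi>)))) \<longlonglongrightarrow>
           pi * wright_Psi11 (- \<nu>) k (- x) / fact k"
proof -
  \<comment> \<open>In this open strip 0 is the only zero of 1 - exp w.\<close>
  define S where "S = {w. Im w < pi} \<inter> {w. Im w > - pi}"
  have S: "open S" "convex S"
    unfolding S_def by (auto intro!: open_Int open_halfspace_Im_lt open_halfspace_Im_gt
        convex_Int convex_halfspace_Im_lt convex_halfspace_Im_gt)
  have ne: "exp w \<noteq> 1" if "w \<in> S - {0}" for w
    using that pi_gt_zero by (intro exp_neq_1_strip) (auto simp: S_def)
  have hol: "q holomorphic_on S - {0}"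
    unfolding q_def by (auto intro!: holomorphic_intros simp: ne)
  have ci: "q contour_integrable_on linepath a b" if "closed_segment a b \<subseteq> S - {0}" for a b
    using that by (intro contour_integrable_continuous_linepath holomorphic_on_imp_continuous_on holomorphic_on_subset[OF hol])
  define T where "T = (\<lambda>n. integral {- real n..real n} (\<lambda>u. q (Complex u \<phi>)))"
  define B where "B = (\<lambda>n. integral {- real n..real n} (\<lambda>u. q (Complex u (-\<phi>))))"
  define E1 where "E1 = (\<lambda>n::nat. contour_integral (linepath (Complex n (-\<phi>)) (Complex n \<phi>)) q)"
  define E2 where "E2 = (\<lambda>n::nat. contour_integral (linepath (Complex (- real n) \<phi>) (Complex (- real n) (-\<phi>))) q)"
  define W where "W = wright_Psi11 (- \<nu>) k (- x) / fact k"
  have seg: "closed_segment (Complex a c) (Complex b d) \<subseteq> S - {0}"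
    if "\<bar>c\<bar> \<le> \<phi>" "\<bar>d\<bar> \<le> \<phi>" "a = b \<and> a \<noteq> 0 \<or> c = d \<and> c \<noteq> 0" for a b c d
  proof -
    have "closed_segment (Complex a c) (Complex b d) \<subseteq> S"
      using that \<phi> by (intro closed_segment_subset S) (auto simp: S_def)
    moreover have "0 \<notin> closed_segment (Complex a c) (Complex b d)"
      using that(3) by (auto simp: closed_segment_same_Re closed_segment_same_Im)
    ultimately show ?thesis by blast
  qed
  \<comment> \<open>Counterclockwise: bottom, right, top run backwards, left. The residue is -
    \<open>W\<close>, whence the sign on the right.\<close>
  have rect: "B n + E1 n - T n + E2 n = - (2 * pi * \<i>) * of_real W" if n: "n > 0" for n
  proof -
    have "contour_integral (rectpath (Complex (- real n) (-\<phi>)) (Complex n \<phi>)) q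
       = 2 * pi * \<i> * (\<Sum>p\<in>{0}. winding_number (rectpath (Complex (- real n) (-\<phi>)) (Complex n \<phi>)) p * residue q p)"
    proof (rule Residue_theorem[OF S(1) convex_connected[OF S(2)]])
      show "path_image (rectpath (Complex (- real n) (-\<phi>)) (Complex n \<phi>)) \<subseteq> S - {0}"
        using n \<phi> by (subst path_image_rectpath_cbox_minus_box)
          (auto simp: in_cbox_complex_iff in_box_complex_iff S_def)
      show "\<forall>z. z \<notin> S \<longrightarrow> winding_number (rectpath (Complex (- real n) (-\<phi>)) (Complex n \<phi>)) z = 0"
        using n \<phi> by (auto intro!: winding_number_rectpath_outside simp: in_cbox_complex_iff S_def)
    qed (use hol in auto)
    also have "(\<Sum>p\<in>{0}. winding_number (rectpath (Complex (- real n) (-\<phi>)) (Complex n \<phi>)) p * residue q p) =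
        winding_number (rectpath (Complex (- real n) (-\<phi>)) (Complex n \<phi>)) 0 * residue q 0"
      by simp
    also have "winding_number (rectpath (Complex (- real n) (-\<phi>)) (Complex n \<phi>)) 0 = 1"
      using n \<phi> by (intro winding_number_rectpath) (auto simp: in_box_complex_iff)
    also have "residue q 0 = - of_real W"
      unfolding q_def W_def by (rule residue_wright)
    also have "contour_integral (rectpath (Complex (- real n) (-\<phi>)) (Complex n \<phi>)) q =
       contour_integral (linepath (Complex (- real n) (-\<phi>)) (Complex n (-\<phi>))) q + (E1 n +
       (contour_integral (linepath (Complex n \<phi>) (Complex (- real n) \<phi>)) q + E2 n))"
      unfolding rectpath_def Let_def E1_def E2_def using n \<phi>
      by (simp add: contour_integral_join contour_integrable_joinI ci seg)
    also have "contour_integral (linepath (Complex (- real n) (-\<phi>)) (Complex n (-\<phi>))) q = B n"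
      using n by (simp add: contour_integral_linepath_same_Im B_def)
    also have "contour_integral (linepath (Complex n \<phi>) (Complex (- real n) \<phi>)) q = - T n"
    proof -
      have "continuous_on (closed_segment (Complex n \<phi>) (Complex (- real n) \<phi>)) q"
        by (rule continuous_on_subset[OF holomorphic_on_imp_continuous_on[OF hol]], rule seg) (use n \<phi> in auto)
      from contour_integral_reverse_linepath[OF this] show ?thesis
        using n by (simp add: contour_integral_linepath_same_Im T_def)
    qed
    finally show ?thesis by (simp add: algebra_simps)
  qed
  have BT: "B n = cnj (T n)" for n
  proof -
    have "cnj (q (Complex u \<phi>)) = q (Complex u (-\<phi>))" for u
      by (simp add: q_def exp_cnj complex_cnj)
    then show ?thesis unfolding B_def T_def by (simp add: Henstock_Kurzweil_Integration.integral_cnj)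
  qed
  have nq: "norm (q w) \<le> exp (Re w) / \<bar>exp (Re w) - 1\<bar> ^ Suc k" if "\<bar>Im w\<bar> \<le> \<phi>" "Re w \<noteq> 0" for w
  proof -
    have "\<bar>\<nu> * Im w\<bar> \<le> \<nu> * \<phi>" using that \<nu> by (simp add: abs_mult mult_left_mono)
    then have "norm (exp (- of_real x * exp (of_real \<nu> * w))) \<le> 1"
      using \<phi> x by (intro norm_exp_wright_le_1) auto
    moreover have "\<bar>exp (Re w) - 1\<bar> \<le> norm (1 - exp w)"
      using norm_triangle_ineq3[of "exp w" 1] by (simp add: norm_minus_commute)
    moreover have "\<bar>exp (Re w) - 1\<bar> > 0" using that by simp
    ultimately show ?thesis
      unfolding q_def norm_divide norm_mult norm_power norm_exp_eq_Re
      by (intro frac_le mult_left_le_one_le power_mono zero_less_power) auto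
  qed
  have E1: "norm (E1 n) \<le> exp (real n) / \<bar>exp (real n) - 1\<bar> ^ Suc k * (2 * \<phi>)" if n: "n > 0" for n
  proof -
    have "norm (E1 n) \<le> exp (real n) / \<bar>exp (real n) - 1\<bar> ^ Suc k * norm (Complex n \<phi> - Complex n (-\<phi>))"
      unfolding E1_def
    proof (rule contour_integral_bound_linepath)
      show "norm (q w) \<le> exp (real n) / \<bar>exp (real n) - 1\<bar> ^ Suc k"
        if "w \<in> closed_segment (Complex n (-\<phi>)) (Complex n \<phi>)" for w
        using nq[of w] that n \<phi> by (auto simp: closed_segment_same_Re closed_segment_eq_real_ivl split: if_splits)
      show "q contour_integrable_on linepath (Complex n (-\<phi>)) (Complex n \<phi>)"
        by (rule ci, rule seg) (use n \<phi> in auto)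
    qed simp
    also have "norm (Complex n \<phi> - Complex n (-\<phi>)) = 2 * \<phi>"
      using \<phi> by (simp add: cmod_eq_Im)
    finally show ?thesis .
  qed
  have E2: "norm (E2 n) \<le> exp (- real n) / \<bar>exp (- real n) - 1\<bar> ^ Suc k * (2 * \<phi>)" if n: "n > 0" for n
  proof -
    have "norm (E2 n) \<le> exp (- real n) / \<bar>exp (- real n) - 1\<bar> ^ Suc k * norm (Complex (- real n) (-\<phi>) - Complex (- real n) \<phi>)"
      unfolding E2_def
    proof (rule contour_integral_bound_linepath)
      show "norm (q w) \<le> exp (- real n) / \<bar>exp (- real n) - 1\<bar> ^ Suc k"
        if "w \<in> closed_segment (Complex (- real n) (\<phi>)) (Complex (- real n) (-\<phi>))" for w
        using nq[of w] that n \<phi> by (auto simp: closed_segment_same_Re closed_segment_eq_real_ivl split: if_splits)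
      show "q contour_integrable_on linepath (Complex (- real n) \<phi>) (Complex (- real n) (-\<phi>))"
        by (rule ci, rule seg) (use n \<phi> in auto)
    qed simp
    also have "norm (Complex (- real n) (-\<phi>) - Complex (- real n) \<phi>) = 2 * \<phi>"
      using \<phi> by (simp add: cmod_eq_Im)
    finally show ?thesis .
  qed
  have ex: "filterlim (\<lambda>n. exp (real n)) at_top sequentially"
    by (intro filterlim_compose[OF exp_at_top] filterlim_real_sequentially)
  have exm: "(\<lambda>n. exp (- real n)) \<longlonglongrightarrow> 0"
    by (intro filterlim_compose[OF exp_at_bot] filterlim_uminus_at_bot_at_top[THEN filterlim_compose] filterlim_real_sequentially)
  have "E2 \<longlonglongrightarrow> 0"
  proof (rule Lim_null_comparison)
    show "\<forall>\<^sub>F n in sequentially. norm (E2 n) \<le> exp (- real n) / \<bar>exp (- real n) - 1\<bar> ^ Suc k * (2 * \<phi>)"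
      using eventually_gt_at_top[of 0] by eventually_elim (rule E2)
    have "(\<lambda>n. exp (- real n) / \<bar>exp (- real n) - 1\<bar> ^ Suc k * (2 * \<phi>)) \<longlonglongrightarrow> 0 / \<bar>0 - 1\<bar> ^ Suc k * (2 * \<phi>)"
      by (intro tendsto_intros exm) auto
    then show "(\<lambda>n. exp (- real n) / \<bar>exp (- real n) - 1\<bar> ^ Suc k * (2 * \<phi>)) \<longlonglongrightarrow> 0" by simp
  qed
  moreover have "E1 \<longlonglongrightarrow> 0"
  proof (rule Lim_null_comparison)
    \<comment> \<open>Two estimates: exp n - 1 >= exp n / 2 >= 1, and the exponent
      \<open>Suc k\<close> is at least 2.\<close>
    have ineq: "exp (real n) / \<bar>exp (real n) - 1\<bar> ^ Suc k \<le> 4 * exp (- real n)" if n: "n > 0" for n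
    proof -
      have e2: "exp (real n) \<ge> 2"
        using exp_ge_add_one_self[of "real n"] n by linarith
      then have "\<bar>exp (real n) - 1\<bar> ^ 2 \<le> \<bar>exp (real n) - 1\<bar> ^ Suc k"
        using k by (intro power_increasing) auto
      moreover have "(exp (real n) / 2) ^ 2 \<le> \<bar>exp (real n) - 1\<bar> ^ 2"
        using e2 by (intro power_mono) auto
      ultimately have "(exp (real n) / 2) ^ 2 \<le> \<bar>exp (real n) - 1\<bar> ^ Suc k" by (rule order_trans[rotated])
      then have "exp (real n) / \<bar>exp (real n) - 1\<bar> ^ Suc k \<le> exp (real n) / ((exp (real n) / 2) ^ 2)"
        by (rule frac_le[OF exp_ge_zero order_refl, rotated]) simp
      also have "\<dots> = 4 * exp (- real n)" by (simp add: exp_minus field_simps power2_eq_square)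
      finally show ?thesis .
    qed
    show "\<forall>\<^sub>F n in sequentially. norm (E1 n) \<le> 4 * exp (- real n) * (2 * \<phi>)"
      using eventually_gt_at_top[of 0]
    proof eventually_elim
      case (elim n)
      show ?case
        using E1[OF elim] mult_right_mono[OF ineq[OF elim], of "2 * \<phi>"] \<phi> by linarith
    qed
    have "(\<lambda>n. 4 * exp (- real n) * (2 * \<phi>)) \<longlonglongrightarrow> 4 * 0 * (2 * \<phi>)"
      by (intro tendsto_intros exm)
    then show "(\<lambda>n. 4 * exp (- real n) * (2 * \<phi>)) \<longlonglongrightarrow> 0" by simp
  qed
  \<comment> \<open>As B is the conjugate of T, Im (B - T) = - 2 Im T, so the rectangle identity can
    be solved for Im T.\<close>
  ultimately have "(\<lambda>n. (2 * pi * W + Im (E1 n + E2 n)) / 2) \<longlonglongrightarrow> (2 * pi * W + Im (0 + 0)) / 2"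
    by (intro tendsto_intros) auto
  moreover have "\<forall>\<^sub>F n in sequentially. (2 * pi * W + Im (E1 n + E2 n)) / 2 = Im (T n)"
    using eventually_gt_at_top[of 0]
  proof eventually_elim
    case (elim n)
    have "Im (B n + E1 n - T n + E2 n) = - 2 * pi * W" unfolding rect[OF elim] by simp
    then show ?case by (simp add: BT)
  qed
  ultimately have "(\<lambda>n. Im (T n)) \<longlonglongrightarrow> (2 * pi * W + Im (0 + 0)) / 2"
    by (rule Lim_transform_eventually)
  then show ?thesis by (simp add: T_def W_def)
qed

text \<open>Dominating function on the ray, with c = - cos \<phi>: there |1 - s| >= 1 - r cos \<phi>
  >= 1, and the exponent k + 1 is at least 2.\<close>

lemma set_integrable_inverse_square:
  fixes c :: real
  assumes c: "c > 0"
  shows "set_integrable lborel {0<..} (\<lambda>r. 1 / (1 + c * r) ^ 2)"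
proof -
  have pos: "0 < 1 + c * r" if "r > 0" for r
    using that c by (simp add: add_pos_pos)
  have "set_integrable lborel (einterval 0 \<infinity>) (\<lambda>r. 1 / (1 + c * r) ^ 2)"
  proof (rule interval_integral_FTC_nonneg(1)[where F = "\<lambda>r. - 1 / (c * (1 + c * r))"])
    show "DERIV (\<lambda>r. - 1 / (c * (1 + c * r))) r :> 1 / (1 + c * r) ^ 2" if "0 < ereal r" for r
      using pos[of r] that c
      by (auto intro!: derivative_eq_intros simp: divide_simps power2_eq_square zero_ereal_def)
    show "isCont (\<lambda>r. 1 / (1 + c * r) ^ 2) r" if "0 < ereal r" for r
      using pos[of r] that by (intro continuous_intros) (auto simp: zero_ereal_def)
    have "((\<lambda>r. - 1 / (c * (1 + c * r))) \<longlongrightarrow> - 1 / (c * (1 + c * 0))) (at_right 0)"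
      using c by (intro tendsto_intros) auto
    then show "(((\<lambda>r. - 1 / (c * (1 + c * r))) \<circ> real_of_ereal) \<longlongrightarrow> - 1 / (c * (1 + c * 0))) (at_right 0)"
      by (simp add: ereal_tendsto_simps1 zero_ereal_def)
    have "((\<lambda>r. - 1 / (c * (1 + c * r))) \<longlongrightarrow> 0) at_top"
      using c by real_asymp
    then show "(((\<lambda>r. - 1 / (c * (1 + c * r))) \<circ> real_of_ereal) \<longlongrightarrow> 0) (at_left \<infinity>)"
      by (simp add: ereal_tendsto_simps1)
  qed auto
  also have "einterval 0 \<infinity> = {0<..}" by (auto simp: einterval_def zero_ereal_def)
  finally show ?thesis .
qed

text \<open>The substitution r = exp u carries the ray to the line Im w = \<phi>; the Jacobian and
  \<open>cis \<phi>\<close> together form the factor exp w of the line integrand. The line integral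
  is known only as a limit over symmetric intervals, so \<open>H\<close> is shown to be absolutely
  integrable and the ray is exhausted by the images of these intervals.\<close>

lemma wright_ray_integral:
  fixes \<nu> \<phi> x :: real and k :: nat
  assumes \<nu>: "\<nu> \<ge> 0" and \<phi>: "pi / 2 < \<phi>" "\<phi> < pi" "\<nu> * \<phi> \<le> pi / 2" and x: "x \<ge> 0" and k: "k > 0"
  defines "H \<equiv> \<lambda>r. cis \<phi> * exp (- of_real (x * r powr \<nu>) * cis (\<nu> * \<phi>)) / (1 - of_real r * cis \<phi>) ^ Suc k"
  shows "Im (LBINT r:{0<..}. H r) = pi * wright_Psi11 (- \<nu>) k (- x) / fact k"
proof -
  have cos_neg: "cos \<phi> < 0"
    using \<phi> cos_lt_zero_pi[of \<phi>] pi_gt_zero by linarith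
  have cos_nn: "cos (\<nu> * \<phi>) \<ge> 0"
    using \<nu> \<phi> pi_gt_zero by (intro cos_ge_zero) (auto intro: order_trans[of _ 0])
  have den: "norm (1 - of_real r * cis \<phi>) \<ge> 1 - r * cos \<phi>" "1 - of_real r * cis \<phi> \<noteq> 0" if "r \<ge> 0" for r
  proof -
    have "r * cos \<phi> \<le> 0" using that cos_neg by (simp add: mult_nonneg_nonpos)
    then have pos: "0 < Re (1 - of_real r * cis \<phi>)" by simp
    then show "1 - of_real r * cis \<phi> \<noteq> 0" by (metis zero_complex.sel(1) less_irrefl)
    show "norm (1 - of_real r * cis \<phi>) \<ge> 1 - r * cos \<phi>"
      using complex_Re_le_cmod[of "1 - of_real r * cis \<phi>"] by simp
  qed
  have cont: "continuous_on {0<..} H"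
    unfolding H_def using den(2)
    by (intro continuous_intros) (simp_all add: less_imp_le del: right_minus_eq)
  have meas: "set_borel_measurable lborel {0<..} H"
    using borel_measurable_continuous_on_indicator[OF _ cont] by (simp add: set_borel_measurable_def)
  let ?c = "- cos \<phi>"
  have bound: "norm (H r) \<le> 1 / (1 + ?c * r) ^ 2" if r: "r > 0" for r
  proof -
    have 1: "1 + ?c * r \<ge> 1" using r cos_neg by (simp add: mult_nonneg_nonpos2 mult_nonpos_nonneg)
    have "(1 + ?c * r) ^ 2 \<le> (1 + ?c * r) ^ Suc k"
      using k 1 by (intro power_increasing) auto
    also have "\<dots> \<le> norm (1 - of_real r * cis \<phi>) ^ Suc k"
      using den(1)[of r] r 1 by (intro power_mono) (auto simp: mult.commute)
    finally have "norm (H r) \<le> 1 / (1 + ?c * r) ^ 2"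
      unfolding H_def norm_divide norm_mult norm_power
      using 1 x cos_nn by (intro frac_le) auto
    then show ?thesis .
  qed
  have int_b: "set_integrable lborel {0<..} (\<lambda>r. 1 / (1 + ?c * r) ^ 2)"
    using cos_neg by (intro set_integrable_inverse_square) auto
  have int: "set_integrable lborel {0<..} H"
    by (rule set_integrable_bound[OF int_b meas]) (use bound in \<open>auto intro!: AE_I2 simp: abs_mult\<close>)
  define q where "q = (\<lambda>w::complex. exp (- of_real x * exp (of_real \<nu> * w)) * exp w / (1 - exp w) ^ Suc k)"
  define I where "I = (\<lambda>n::nat. {exp (- real n)..exp (real n)})"
  have Iint: "(LBINT r:I n. H r) = integral {- real n..real n} (\<lambda>u. q (Complex u \<phi>))" for n
  proof -
    have "set_integrable lborel (I n) H"
      by (rule set_integrable_subset[OF int]) (auto simp: I_def intro: less_le_trans[OF exp_gt_zero])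
    then have "(LBINT r:I n. H r) = integral (I n) H"
      by (rule set_borel_integral_eq_integral)
    moreover have "((\<lambda>u. exp u *\<^sub>R H (exp u)) has_integral (integral {exp (- real n)..exp (real n)} H)) {- real n..real n}"
      by (rule has_integral_substitution[where c = "exp (- real n)" and d = "exp (real n)"])
        (auto intro!: continuous_on_subset[OF cont] derivative_eq_intros intro: less_le_trans[OF exp_gt_zero])
    moreover have "exp u *\<^sub>R H (exp u) = q (Complex u \<phi>)" for u
    proof -
      have 1: "exp (Complex u \<phi>) = of_real (exp u) * cis \<phi>"
        by (simp add: exp_eq_polar)
      have 2: "exp (of_real \<nu> * Complex u \<phi>) = of_real (exp u powr \<nu>) * cis (\<nu> * \<phi>)"
        by (simp add: exp_eq_polar powr_def)
      show ?thesis unfolding q_def H_def 1 2 by (simp add: scaleR_conv_of_real mult_ac)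
    qed
    ultimately show ?thesis by (simp add: I_def integral_unique)
  qed
  have UI: "(\<Union>n. I n) = {0<..}"
  proof (intro equalityI subsetI)
    fix r :: real assume "r \<in> {0<..}"
    then have r: "r > 0" by simp
    obtain n :: nat where "\<bar>ln r\<bar> \<le> n" using real_arch_simple by blast
    then have "- real n \<le> ln r" "ln r \<le> real n" by auto
    then have "r \<in> I n"
      using r by (simp add: I_def ln_ge_iff) (metis exp_le_cancel_iff exp_ln)
    then show "r \<in> (\<Union>n. I n)" by blast
  qed (auto simp: I_def intro: less_le_trans[OF exp_gt_zero])
  have "(\<lambda>n. LBINT r:I n. H r) \<longlonglongrightarrow> (LBINT r:(\<Union>n. I n). H r)"
    by (rule set_integral_cont_up) (auto simp: I_def incseq_def int UI[unfolded I_def])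
  then have "(\<lambda>n. Im (integral {- real n..real n} (\<lambda>u. q (Complex u \<phi>)))) \<longlonglongrightarrow> Im (LBINT r:{0<..}. H r)"
    unfolding Iint UI by (rule tendsto_Im)
  moreover have "(\<lambda>n. Im (integral {- real n..real n} (\<lambda>u. q (Complex u \<phi>)))) \<longlonglongrightarrow>
           pi * wright_Psi11 (- \<nu>) k (- x) / fact k"
    unfolding q_def using \<nu> \<phi> x k pi_gt_zero by (intro wright_line_integral) linarith+
  ultimately show ?thesis
    by (rule LIMSEQ_unique)
qed

section \<open>The Laplace transform of the Wright function\<close>

lemma wright_phi0_laplace:
  fixes \<nu> x :: real and k :: nat
  assumes \<nu>: "0 < \<nu>" "\<nu> < 1" and x: "x \<ge> 0" and k: "k > 0"
  shows "set_integrable lborel {0<..} (\<lambda>t. exp (- t) * t powr (real k - 1) * wright_phi0 \<nu> (x * t powr - \<nu>))"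
    and "(LBINT t:{0<..}. exp (- t) * t powr (real k - 1) * wright_phi0 \<nu> (x * t powr - \<nu>))
           = wright_Psi11 (- \<nu>) k (- x)"
proof -
  \<comment> \<open>The interval from pi/2 to pi / (2 \<nu>) is nonempty because \<nu> < 1.\<close>
  obtain \<phi> where \<phi>: "pi / 2 < \<phi>" "\<phi> < pi" "\<nu> * \<phi> \<le> pi / 2"
  proof -
    have "pi / 2 < min pi (pi / (2 * \<nu>))"
      using \<nu> by (simp add: field_simps)
    then obtain \<phi> where "pi / 2 < \<phi>" "\<phi> < min pi (pi / (2 * \<nu>))" using dense by blast
    then show ?thesis using that[of \<phi>] \<nu> by (simp add: field_simps)
  qed
  have cos_neg: "cos \<phi> < 0"
    using \<phi> cos_lt_zero_pi[of \<phi>] pi_gt_zero by linarith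
  have cos_nn: "cos (\<nu> * \<phi>) \<ge> 0"
    using \<nu> \<phi> pi_gt_zero by (intro cos_ge_zero) (auto intro: order_trans[of _ 0])
  define e where "e = (\<lambda>r. exp (- of_real (x * r powr \<nu>) * cis (\<nu> * \<phi>)))"
  define a where "a = (\<lambda>r. 1 - of_real r * cis \<phi>)"
  define H where "H = (\<lambda>r. cis \<phi> * e r / a r ^ Suc k)"
  define h where "h = (\<lambda>t r. cis \<phi> * exp (of_real (t * r) * cis \<phi>) * e r)"
  \<comment> \<open>The power of t is t^k, one more than in the claim, because the ray integral at
    fixed t yields the Wright function divided by t.\<close>
  define K where "K = (\<lambda>r t. (indicator {0<..} r *\<^sub>R (cis \<phi> * e r)) *
      (indicator {0<..} t *\<^sub>R (of_real (t powr (real (Suc k) - 1)) * exp (- a r * of_real t))))"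
  have Re_a: "Re (a r) = 1 - r * cos \<phi>" for r by (simp add: a_def)
  have Re_a_pos: "Re (a r) > 0" if "r > 0" for r
    using that cos_neg mult_pos_neg[of r "cos \<phi>"] by (simp add: Re_a)
  have H_int: "Im (LBINT r:{0<..}. H r) = pi * wright_Psi11 (- \<nu>) k (- x) / fact k"
    unfolding H_def e_def a_def using \<nu> \<phi> x k by (intro wright_ray_integral) auto
  have Gam: "Gamma (real (Suc k)) = fact k" using Gamma_fact[of k, where 'a = real] by (simp add: add.commute)
  have inner_t: "has_bochner_integral lborel (K r) (fact k * (indicator {0<..} r *\<^sub>R H r))" for r
  proof (cases "r > 0")
    case True
    have "has_bochner_integral lborel (K r) ((indicator {0<..} r *\<^sub>R (cis \<phi> * e r)) *
        (of_real (Gamma (real (Suc k))) * a r powr (- of_real (real (Suc k)))))"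
      unfolding K_def using Re_a_pos[OF True]
      by (intro has_bochner_integral_mult_right has_bochner_integral_Gamma_complex) auto
    also have "a r powr (- of_real (real (Suc k))) = inverse (a r ^ Suc k)"
    proof -
      have "a r \<noteq> 0" using Re_a_pos[OF True] by auto
      then show ?thesis using powr_nat[of "a r" "Suc k"] by (simp add: powr_minus del: of_nat_Suc power_Suc)
    qed
    finally show ?thesis unfolding Gam H_def using True by (simp add: divide_inverse mult_ac)
  next
    case False
    then have "K r = (\<lambda>t. 0)" by (auto simp: K_def)
    then show ?thesis using False by (simp add: has_bochner_integral_zero)
  qed
  have inner_norm: "has_bochner_integral lborel (\<lambda>t. norm (K r t))
      (norm (indicator {0<..} r *\<^sub>R (cis \<phi> * e r)) * (fact k / (1 - r * cos \<phi>) ^ Suc k))" for r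
  proof (cases "r > 0")
    case True
    have "has_bochner_integral lborel (\<lambda>t. norm (indicator {0<..} r *\<^sub>R (cis \<phi> * e r)) *
       (indicator {0<..} t * (t powr (real (Suc k) - 1) * exp (- Re (a r) * t))))
       (norm (indicator {0<..} r *\<^sub>R (cis \<phi> * e r)) * (Gamma (real (Suc k)) / Re (a r) powr (real (Suc k))))"
      using Re_a_pos[OF True] by (intro has_bochner_integral_mult_right has_bochner_integral_Gamma_real) auto
    also have "Re (a r) powr (real (Suc k)) = (1 - r * cos \<phi>) ^ Suc k"
      using Re_a_pos[OF True] by (subst powr_realpow) (auto simp: Re_a)
    also have "(\<lambda>t. norm (indicator {0<..} r *\<^sub>R (cis \<phi> * e r)) *
       (indicator {0<..} t * (t powr (real (Suc k) - 1) * exp (- Re (a r) * t)))) = (\<lambda>t. norm (K r t))"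
      by (simp add: K_def norm_mult mult_ac)
    finally show ?thesis unfolding Gam .
  qed (simp add: K_def has_bochner_integral_zero)
  have meas_K: "(\<lambda>(r, t). K r t) \<in> borel_measurable (lborel \<Otimes>\<^sub>M lborel)"
    unfolding K_def e_def a_def by measurable
  \<comment> \<open>Integrated over t, the norm of \<open>K\<close> is at most k! / (1 - r cos
    \<phi>)^(k + 1), hence at most k! / (1 - r cos \<phi>)^2, which is integrable in r.\<close>
  have int_K: "integrable (lborel \<Otimes>\<^sub>M lborel) (\<lambda>(r, t). K r t)"
  proof (rule lborel_pair.Fubini_integrable[OF meas_K])
    show "AE r in lborel. integrable lborel (\<lambda>t. (\<lambda>(r, t). K r t) (r, t))"
      using inner_t by (auto simp: has_bochner_integral_iff)
    have "integrable lborel (\<lambda>r. norm (indicator {0<..} r *\<^sub>R (cis \<phi> * e r)) * (fact k / (1 - r * cos \<phi>) ^ Suc k))"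
    proof (rule Bochner_Integration.integrable_bound)
      have "set_integrable lborel {0<..} (\<lambda>r. fact k * (1 / (1 + - cos \<phi> * r) ^ 2))"
        using cos_neg by (intro set_integrable_mult_right set_integrable_inverse_square) auto
      then show "integrable lborel (\<lambda>r. indicator {0<..} r *\<^sub>R (fact k * (1 / (1 + - cos \<phi> * r) ^ 2)))"
        by (simp add: set_integrable_def)
      show "(\<lambda>r. norm (indicator {0<..} r *\<^sub>R (cis \<phi> * e r)) * (fact k / (1 - r * cos \<phi>) ^ Suc k))
          \<in> borel_measurable lborel"
        unfolding e_def by measurable
      have "norm (norm (indicator {0<..} r *\<^sub>R (cis \<phi> * e r)) * (fact k / (1 - r * cos \<phi>) ^ Suc k))
          \<le> norm (indicator {0<..} r *\<^sub>R (fact k * (1 / (1 + - cos \<phi> * r) ^ 2)) :: real)" for r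
      proof (cases "r > 0")
        case True
        have "norm (e r) \<le> 1" using x cos_nn by (simp add: e_def)
        moreover have ge1: "1 - r * cos \<phi> \<ge> 1"
          using True cos_neg mult_pos_neg[of r "cos \<phi>"] by simp
        then have "(1 - r * cos \<phi>) ^ 2 \<le> (1 - r * cos \<phi>) ^ Suc k"
          using k by (intro power_increasing) auto
        ultimately have "norm (e r) * (fact k / (1 - r * cos \<phi>) ^ Suc k) \<le> 1 * (fact k / (1 - r * cos \<phi>) ^ 2)"
          using ge1 by (intro mult_mono divide_left_mono) auto
        moreover have "norm (e r) * (fact k / (1 - r * cos \<phi>) ^ Suc k) \<ge> 0"
          using ge1 by (intro mult_nonneg_nonneg divide_nonneg_nonneg) auto
        ultimately show ?thesis
          using True by (simp add: norm_mult mult.commute del: power_Suc)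
      qed simp
      then show "AE r in lborel. norm (norm (indicator {0<..} r *\<^sub>R (cis \<phi> * e r)) * (fact k / (1 - r * cos \<phi>) ^ Suc k))
          \<le> norm (indicator {0<..} r *\<^sub>R (fact k * (1 / (1 + - cos \<phi> * r) ^ 2)) :: real)"
        by simp
    qed
    then show "integrable lborel (\<lambda>r. \<integral>t. norm ((\<lambda>(r, t). K r t) (r, t)) \<partial>lborel)"
      by (simp add: has_bochner_integral_integral_eq[OF inner_norm])
  qed
  have inner_r: "(\<integral>r. K r t \<partial>lborel) = indicator {0<..} t *\<^sub>R (of_real (t ^ k * exp (- t)) * (LBINT r:{0<..}. h t r))" for t
  proof (cases "t > 0")
    case True
    have "K r t = of_real (t ^ k * exp (- t)) * (indicator {0<..} r *\<^sub>R h t r)" for r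
    proof -
      have "exp (- a r * of_real t) = of_real (exp (- t)) * exp (of_real (t * r) * cis \<phi>)"
        by (simp add: a_def exp_of_real[symmetric] exp_add[symmetric] algebra_simps)
      then show ?thesis
        using True by (simp add: K_def h_def powr_realpow scaleR_conv_of_real mult_ac)
    qed
    then have "(\<integral>r. K r t \<partial>lborel) = of_real (t ^ k * exp (- t)) * (LBINT r:{0<..}. h t r)"
      unfolding set_lebesgue_integral_def by (simp only: integral_mult_right_zero)
    then show ?thesis using True by simp
  qed (simp add: K_def)
  have Im_r: "Im (\<integral>r. K r t \<partial>lborel) = pi * (indicator {0<..} t *\<^sub>R (exp (- t) * t powr (real k - 1) * wright_phi0 \<nu> (x * t powr - \<nu>)))" for t
  proof (cases "t > 0")
    case True
    have 1: "Im (LBINT r:{0<..}. h t r) = pi / t * wright_phi0 \<nu> (x * t powr - \<nu>)"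
      unfolding h_def e_def using \<nu> \<phi> x True by (intro wright_phi0_ray_integral(2)) auto
    have 2: "t powr (real k - 1) = t ^ k / t"
      using True by (simp add: powr_diff powr_realpow)
    have Im_mult: "Im (of_real u * v) = u * Im v" for u v by simp
    show ?thesis
      using True unfolding inner_r 2 by (simp only: indicator_simps greaterThan_iff scaleR_one Im_mult 1) simp
  qed (simp add: inner_r)
  have "integrable lborel (\<lambda>t. \<integral>r. K r t \<partial>lborel)"
    using lborel_pair.integrable_snd[OF int_K] .
  then have int1: "integrable lborel (\<lambda>t. Im (\<integral>r. K r t \<partial>lborel))" by (rule integrable_Im)
  then show "set_integrable lborel {0<..} (\<lambda>t. exp (- t) * t powr (real k - 1) * wright_phi0 \<nu> (x * t powr - \<nu>))"
    unfolding Im_r set_integrable_def by simp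
  have "pi * (LBINT t:{0<..}. exp (- t) * t powr (real k - 1) * wright_phi0 \<nu> (x * t powr - \<nu>))
      = (\<integral>t. Im (\<integral>r. K r t \<partial>lborel) \<partial>lborel)"
    unfolding Im_r set_lebesgue_integral_def by simp
  also have "\<dots> = Im (\<integral>t. (\<integral>r. K r t \<partial>lborel) \<partial>lborel)"
    using lborel_pair.integrable_snd[OF int_K] by (rule integral_Im)
  also have "(\<integral>t. (\<integral>r. K r t \<partial>lborel) \<partial>lborel) = (\<integral>r. (\<integral>t. K r t \<partial>lborel) \<partial>lborel)"
    by (rule lborel_pair.Fubini_integral[OF int_K])
  also have "\<dots> = fact k * (LBINT r:{0<..}. H r)"
    unfolding has_bochner_integral_integral_eq[OF inner_t] set_lebesgue_integral_def
    by (simp only: integral_mult_right_zero)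
  also have "Im \<dots> = fact k * Im (LBINT r:{0<..}. H r)"
    by simp
  also have "\<dots> = pi * wright_Psi11 (- \<nu>) k (- x)"
    unfolding H_int by simp
  finally show "(LBINT t:{0<..}. exp (- t) * t powr (real k - 1) * wright_phi0 \<nu> (x * t powr - \<nu>))
           = wright_Psi11 (- \<nu>) k (- x)"
    by simp
qed

section \<open>The cases 1/3 and 2/3\<close>

lemma suminf_mult_eq:
  fixes c :: real
  assumes "(\<lambda>n. c * f n) sums s" "c \<noteq> 0"
  shows "c * suminf f = s"
  using sums_unique[OF sums_mult_D[OF assms], symmetric] assms(2) by simp

lemma summable_norm_subseq:
  fixes a :: "nat \<Rightarrow> 'a :: banach"
  assumes "summable (\<lambda>n. norm (a n))" "inj g"
  shows "summable (\<lambda>n. a (g n))"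
proof -
  have "summable ((\<lambda>n. norm (a n)) \<circ> g)"
    using assms by (intro summable_reindex) auto
  then show ?thesis unfolding o_def by (rule summable_norm_cancel)
qed

lemma suminf_mod_3:
  fixes a :: "nat \<Rightarrow> 'a :: banach"
  assumes a: "summable (\<lambda>n. norm (a n))" and a0: "\<And>m. a (3 * m) = 0"
  shows "(\<Sum>n. a n) = (\<Sum>m. a (3 * m + 1)) + (\<Sum>m. a (3 * m + 2))"
proof -
  have "a sums (\<Sum>n. a n)" by (rule summable_sums[OF summable_norm_cancel[OF a]])
  then have s1: "(\<lambda>m. sum a {m * 3..<m * 3 + 3}) sums (\<Sum>n. a n)"
    by (rule sums_group) simp
  have block: "sum a {m * 3..<m * 3 + 3} = a (3 * m + 1) + a (3 * m + 2)" for m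
  proof -
    have "{m * 3..<m * 3 + 3} = {3 * m, 3 * m + 1, 3 * m + 2}" by auto
    then show ?thesis using a0[of m] by simp
  qed
  have s2: "(\<lambda>m. a (3 * m + 1) + a (3 * m + 2)) sums ((\<Sum>m. a (3 * m + 1)) + (\<Sum>m. a (3 * m + 2)))"
    by (intro sums_add summable_sums summable_norm_subseq[OF a]) (auto simp: inj_def)
  show ?thesis using s1 s2 unfolding block by (rule sums_unique2)
qed

section \<open>Coefficients of the Wright series along residue classes mod 3\<close>

lemma rGamma_plus1_cong: "y = x + 1 \<Longrightarrow> rGamma (x::real) = x * rGamma y"
  by (simp add: rGamma_plus1)

lemma power_3_Suc: "a ^ (3 * Suc m + j) = a ^ 3 * (a :: real) ^ (3 * m + j)"
proof -
  have "3 * Suc m + j = 3 + (3 * m + j)" by simp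
  then show ?thesis by (simp only: power_add)
qed

text \<open>Raising m by 1 moves the argument of \<open>rGamma\<close> by 1 and adds three factors
  to the factorial, one of which cancels up to 1/3. What remains, 1 / (27 (m + 1) (m + 2/3)), is the
  ratio of consecutive terms for I of order - 1/3.\<close>

lemma wright_coeff_third_1:
  "(- 1) ^ (3 * m + 1) * rGamma (- (1/3) * real (3 * m + 1)) / fact (3 * m + 1)
     = (1/3) ^ (3 * m + 1) * rGamma (real m + 2/3) / fact m" (is "?L m = _")
proof (induction m)
  case 0
  show ?case using rGamma_plus1_cong[of "2/3" "- (1/3)"] by simp
next
  case (Suc m)
  have 1: "rGamma (- (1/3) * real (3 * Suc m + 1)) = - (real m + 4/3) * rGamma (- (1/3) * real (3 * m + 1))"
    by (subst rGamma_plus1_cong[of "- (1/3) * real (3 * m + 1)"]) (auto simp: algebra_simps)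
  have 2: "rGamma (real m + 2/3) = (real m + 2/3) * rGamma (real (Suc m) + 2/3)"
    by (rule rGamma_plus1_cong) auto
  have 3: "fact (3 * Suc m + 1) = (3 * real m + 4) * (3 * (real m + 1)) * (3 * (real m + 2/3)) * fact (3 * m + 1)"
    by (simp add: numeral_3_eq_3 algebra_simps)
  have 4: "(- 1 :: real) ^ (3 * Suc m + 1) = - ((- 1) ^ (3 * m + 1))" unfolding power_3_Suc by simp
  have 5: "(1/3 :: real) ^ (3 * Suc m + 1) = (1/3) ^ (3 * m + 1) / 27" unfolding power_3_Suc by (simp add: power3_eq_cube)
  have "(- 1) ^ (3 * Suc m + 1) * rGamma (- (1/3) * real (3 * Suc m + 1)) / fact (3 * Suc m + 1)
     = (real m + 4/3) / ((3 * real m + 4) * (3 * (real m + 1)) * (3 * (real m + 2/3))) *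
       ((- 1) ^ (3 * m + 1) * rGamma (- (1/3) * real (3 * m + 1)) / fact (3 * m + 1))"
  proof -
    have "- P * (- c * R) / (D * F) = c / D * (P * R / F)" for P c R D F :: real by simp
    then show ?thesis unfolding 1 3 4 .
  qed
  also have "(real m + 4/3) / ((3 * real m + 4) * (3 * (real m + 1)) * (3 * (real m + 2/3))) = 1 / (27 * (real m + 1) * (real m + 2/3))"
    by (simp add: divide_simps) (simp add: algebra_simps)
  finally have 6: "?L (Suc m) = 1 / (27 * (real m + 1) * (real m + 2/3)) * ?L m" .
  have 7: "fact (Suc m) = (real m + 1) * fact m" by (simp add: algebra_simps)
  have cancel: "1 / (27 * A * B) * (P * (B * R) / F) = (P / 27 * R / (A * F))" if "B \<noteq> 0" for A B P R F :: real
    using that by simp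
  show ?case unfolding 6 Suc.IH 2 5 7 by (rule cancel) simp
qed

text \<open>The same cancellation in the class of 2 leaves the coefficients of I of order 1/3; the
  minus sign becomes the one in the definition of K.\<close>

lemma wright_coeff_third_2:
  "(- 1) ^ (3 * m + 2) * rGamma (- (1/3) * real (3 * m + 2)) / fact (3 * m + 2)
     = - ((1/3) ^ (3 * m + 2) * rGamma (real m + 4/3) / fact m)" (is "?L m = _")
proof (induction m)
  case 0
  show ?case using rGamma_plus1_cong[of "1/3" "- (2/3)"] rGamma_plus1_cong[of "4/3" "1/3"]
    by (simp add: fact_numeral power2_eq_square)
next
  case (Suc m)
  have 1: "rGamma (- (1/3) * real (3 * Suc m + 2)) = - (real m + 5/3) * rGamma (- (1/3) * real (3 * m + 2))"
    by (subst rGamma_plus1_cong[of "- (1/3) * real (3 * m + 2)"]) (auto simp: algebra_simps)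
  have 2: "rGamma (real m + 4/3) = (real m + 4/3) * rGamma (real (Suc m) + 4/3)"
    by (rule rGamma_plus1_cong) auto
  have 3: "fact (3 * Suc m + 2) = (3 * real m + 5) * (3 * (real m + 4/3)) * (3 * (real m + 1)) * fact (3 * m + 2)"
    by (simp add: numeral_3_eq_3 algebra_simps)
  have 4: "(- 1 :: real) ^ (3 * Suc m + 2) = - ((- 1) ^ (3 * m + 2))" unfolding power_3_Suc by simp
  have 5: "(1/3 :: real) ^ (3 * Suc m + 2) = (1/3) ^ (3 * m + 2) / 27" unfolding power_3_Suc by (simp add: power3_eq_cube)
  have "(- 1) ^ (3 * Suc m + 2) * rGamma (- (1/3) * real (3 * Suc m + 2)) / fact (3 * Suc m + 2)
     = (real m + 5/3) / ((3 * real m + 5) * (3 * (real m + 4/3)) * (3 * (real m + 1))) *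
       ((- 1) ^ (3 * m + 2) * rGamma (- (1/3) * real (3 * m + 2)) / fact (3 * m + 2))"
  proof -
    have "- P * (- c * R) / (D * F) = c / D * (P * R / F)" for P c R D F :: real by simp
    then show ?thesis unfolding 1 3 4 .
  qed
  also have "(real m + 5/3) / ((3 * real m + 5) * (3 * (real m + 4/3)) * (3 * (real m + 1))) = 1 / (27 * (real m + 1) * (real m + 4/3))"
    by (simp add: divide_simps) (simp add: algebra_simps)
  finally have 6: "?L (Suc m) = 1 / (27 * (real m + 1) * (real m + 4/3)) * ?L m" .
  have 7: "fact (Suc m) = (real m + 1) * fact m" by (simp add: algebra_simps)
  have cancel: "1 / (27 * A * B) * - (P * (B * R) / F) = - (P / 27 * R / (A * F))" if "B \<noteq> 0" for A B P R F :: real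
    using that by simp
  show ?case unfolding 6 Suc.IH 2 5 7 by (rule cancel) simp
qed

text \<open>Here the argument of \<open>rGamma\<close> moves by 2. The new factor 2 m + 8/3 cancels
  3 m + 4 up to 2/3; 2 m + 5/3 = 2 (m + 5/6) gives the upper and 3 m + 2 = 3 (m + 2/3) the lower
  Kummer parameter. The constants combine to - 4/27.\<close>

lemma wright_coeff_two_thirds_1:
  "(- 1) ^ (3 * m + 1) * rGamma (- (2/3) * real (3 * m + 1)) / fact (3 * m + 1)
     = - rGamma (- (2/3)) * (pochhammer (5/6) m / pochhammer (2/3) m * (- (4/27)) ^ m / fact m)" (is "?L m = _")
proof (induction m)
  case 0
  show ?case by simp
next
  case (Suc m)
  have 1: "rGamma (- (2/3) * real (3 * Suc m + 1)) = (2 * real m + 8/3) * (2 * real m + 5/3) * rGamma (- (2/3) * real (3 * m + 1))"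
  proof -
    have e: "- (2/3) * real (3 * Suc m + 1) = - (2 * real m + 8/3)" by (simp add: field_simps)
    have 1: "rGamma (- (2 * real m + 8/3)) = - (2 * real m + 8/3) * rGamma (- (2 * real m + 5/3))"
      by (rule rGamma_plus1_cong) (simp add: field_simps)
    have 2: "rGamma (- (2 * real m + 5/3)) = - (2 * real m + 5/3) * rGamma (- (2/3) * real (3 * m + 1))"
      by (rule rGamma_plus1_cong) (simp add: field_simps)
    show ?thesis unfolding e 1 2 by (simp only: minus_mult_left[symmetric] minus_mult_right minus_minus mult.assoc)
  qed
  have 3: "fact (3 * Suc m + 1) = (3 * real m + 4) * (3 * (real m + 1)) * (3 * (real m + 2/3)) * fact (3 * m + 1)"
    by (simp add: numeral_3_eq_3 algebra_simps)
  have 4: "(- 1 :: real) ^ (3 * Suc m + 1) = - ((- 1) ^ (3 * m + 1))" unfolding power_3_Suc by simp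
  have "(- 1) ^ (3 * Suc m + 1) * rGamma (- (2/3) * real (3 * Suc m + 1)) / fact (3 * Suc m + 1)
     = - ((2 * real m + 8/3) * (2 * real m + 5/3)) / ((3 * real m + 4) * (3 * (real m + 1)) * (3 * (real m + 2/3))) *
       ((- 1) ^ (3 * m + 1) * rGamma (- (2/3) * real (3 * m + 1)) / fact (3 * m + 1))"
  proof -
    have "- P * (c * R) / (D * F) = - c / D * (P * R / F)" for P c R D F :: real by simp
    then show ?thesis unfolding 1 3 4 .
  qed
  also have "- ((2 * real m + 8/3) * (2 * real m + 5/3)) / ((3 * real m + 4) * (3 * (real m + 1)) * (3 * (real m + 2/3)))
     = (5/6 + real m) / (2/3 + real m) * (- (4/27)) / (real m + 1)"
    by (simp add: divide_simps) (simp add: algebra_simps)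
  finally have 6: "?L (Suc m) = (5/6 + real m) / (2/3 + real m) * (- (4/27)) / (real m + 1) * ?L m" .
  have 7: "fact (Suc m) = (real m + 1) * fact m" by (simp add: algebra_simps)
  have "(A / B * c / N) * (r * (P / Q * E / F)) = r * (P * A / (Q * B) * (c * E) / (N * F))" for A B c N r P Q E F :: real
    by (simp add: mult_ac)
  then show ?case unfolding 6 Suc.IH 7 pochhammer_Suc power_Suc .
qed

text \<open>Now 2 m + 10/3 cancels 3 m + 5 up to 2/3, while 2 m + 7/3 and 3 m + 4 give the
  parameters 7/6 and 4/3. The initial factor 1/2 is 1 / 2!.\<close>

lemma wright_coeff_two_thirds_2:
  "(- 1) ^ (3 * m + 2) * rGamma (- (2/3) * real (3 * m + 2)) / fact (3 * m + 2)
     = rGamma (- (4/3)) / 2 * (pochhammer (7/6) m / pochhammer (4/3) m * (- (4/27)) ^ m / fact m)" (is "?L m = _")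
proof (induction m)
  case 0
  show ?case by (simp add: fact_numeral)
next
  case (Suc m)
  have 1: "rGamma (- (2/3) * real (3 * Suc m + 2)) = (2 * real m + 10/3) * (2 * real m + 7/3) * rGamma (- (2/3) * real (3 * m + 2))"
  proof -
    have e: "- (2/3) * real (3 * Suc m + 2) = - (2 * real m + 10/3)" by (simp add: field_simps)
    have 1: "rGamma (- (2 * real m + 10/3)) = - (2 * real m + 10/3) * rGamma (- (2 * real m + 7/3))"
      by (rule rGamma_plus1_cong) (simp add: field_simps)
    have 2: "rGamma (- (2 * real m + 7/3)) = - (2 * real m + 7/3) * rGamma (- (2/3) * real (3 * m + 2))"
      by (rule rGamma_plus1_cong) (simp add: field_simps)
    show ?thesis unfolding e 1 2 by (simp only: minus_mult_left[symmetric] minus_mult_right minus_minus mult.assoc)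
  qed
  have 3: "fact (3 * Suc m + 2) = (3 * real m + 5) * (3 * (real m + 4/3)) * (3 * (real m + 1)) * fact (3 * m + 2)"
    by (simp add: numeral_3_eq_3 algebra_simps)
  have 4: "(- 1 :: real) ^ (3 * Suc m + 2) = - ((- 1) ^ (3 * m + 2))" unfolding power_3_Suc by simp
  have "(- 1) ^ (3 * Suc m + 2) * rGamma (- (2/3) * real (3 * Suc m + 2)) / fact (3 * Suc m + 2)
     = - ((2 * real m + 10/3) * (2 * real m + 7/3)) / ((3 * real m + 5) * (3 * (real m + 4/3)) * (3 * (real m + 1))) *
       ((- 1) ^ (3 * m + 2) * rGamma (- (2/3) * real (3 * m + 2)) / fact (3 * m + 2))"
  proof -
    have "- P * (c * R) / (D * F) = - c / D * (P * R / F)" for P c R D F :: real by simp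
    then show ?thesis unfolding 1 3 4 .
  qed
  also have "- ((2 * real m + 10/3) * (2 * real m + 7/3)) / ((3 * real m + 5) * (3 * (real m + 4/3)) * (3 * (real m + 1)))
     = (7/6 + real m) / (4/3 + real m) * (- (4/27)) / (real m + 1)"
    by (simp add: divide_simps) (simp add: algebra_simps)
  finally have 6: "?L (Suc m) = (7/6 + real m) / (4/3 + real m) * (- (4/27)) / (real m + 1) * ?L m" .
  have 7: "fact (Suc m) = (real m + 1) * fact m" by (simp add: algebra_simps)
  have "(A / B * c / N) * (r * (P / Q * E / F)) = r * (P * A / (Q * B) * (c * E) / (N * F))" for A B c N r P Q E F :: real
    by (simp add: mult_ac)
  then show ?case unfolding 6 Suc.IH 7 pochhammer_Suc power_Suc .
qed

lemma wright_phi0_mod_3: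
  assumes \<nu>: "\<nu> = 1/3 \<or> \<nu> = 2/3"
  defines "c \<equiv> \<lambda>n. (- 1) ^ n * rGamma (- \<nu> * real n) / fact n"
  shows "wright_phi0 \<nu> z = (\<Sum>m. c (3 * m + 1) * z ^ (3 * m + 1)) + (\<Sum>m. c (3 * m + 2) * z ^ (3 * m + 2))"
    and "summable (\<lambda>m. c (3 * m + 1) * z ^ (3 * m + 1))"
    and "summable (\<lambda>m. c (3 * m + 2) * z ^ (3 * m + 2))"
proof -
  have eq: "(- z) ^ n * rGamma (- \<nu> * real n) / fact n = c n * z ^ n" for n
    by (simp add: c_def power_minus[of z])
  have sm: "summable (\<lambda>n. norm (c n * z ^ n))"
    unfolding eq[symmetric] using \<nu> by (intro summable_wright_phi0) auto
  show "summable (\<lambda>m. c (3 * m + 1) * z ^ (3 * m + 1))" "summable (\<lambda>m. c (3 * m + 2) * z ^ (3 * m + 2))"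
    by (rule summable_norm_subseq[OF sm], simp add: inj_def)+
  \<comment> \<open>The argument of \<open>rGamma\<close> is - m or - 2 m, a pole of Gamma.\<close>
  have "c (3 * m) = 0" for m
  proof -
    obtain j :: nat where "- \<nu> * real (3 * m) = - real j"
      using \<nu> that[of m] that[of "2 * m"] by auto
    then show ?thesis by (simp add: c_def rGamma_eq_zero_iff)
  qed
  then show "wright_phi0 \<nu> z = (\<Sum>m. c (3 * m + 1) * z ^ (3 * m + 1)) + (\<Sum>m. c (3 * m + 2) * z ^ (3 * m + 2))"
    unfolding wright_phi0_def eq by (intro suminf_mod_3 sm) auto
qed

section \<open>The Bessel case, nu = 1/3\<close>

lemma one_third_not_Ints: "(1/3 :: real) \<notin> \<int>"
proof
  assume "(1/3 :: real) \<in> \<int>"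
  then obtain n :: int where "1/3 = real_of_int n" by (elim Ints_cases)
  then have "real_of_int (3 * n) = real_of_int 1" by simp
  then have "3 * n = 1" by (simp only: of_int_eq_iff)
  then show False by presburger
qed

text \<open>With w = z / 3, half of the Bessel argument is w^(3/2). Multiplication by w^(3/2) turns
  the exponents of the series of I of order - 1/3 and 1/3 into 3 m + 1 and 3 m + 2, the two
  surviving residue classes.\<close>

lemma wright_phi0_third:
  assumes z: "z > 0"
  shows "z powr (3/2) / (3 * pi) * bessel_K (1/3) (2 * z powr (3/2) / (3 * sqrt 3)) = wright_phi0 (1/3) z"
proof -
  define w where "w = z / 3"
  have w: "w > 0" using z by (simp add: w_def)
  define y where "y = 2 * z powr (3/2) / (3 * sqrt 3)"
  have "w powr (3/2) = z powr (3/2) / 3 powr (1 + 1/2)"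
    using z by (simp add: w_def powr_divide)
  also have "3 powr (1 + 1/2 :: real) = 3 * sqrt 3"
    unfolding powr_add by (simp add: powr_half_sqrt)
  finally have w32: "w powr (3/2) = z powr (3/2) / (3 * sqrt 3)" .
  have y2: "y / 2 = w powr (3/2)" by (simp add: y_def w32)
  have I1: "w powr (3/2) * ((y / 2) powr (2 * real m + - (1/3)) / fact m * rGamma (real m + - (1/3) + 1))
      = ((- 1) ^ (3 * m + 1) * rGamma (- (1/3) * real (3 * m + 1)) / fact (3 * m + 1)) * z ^ (3 * m + 1)" for m
  proof -
    have "w powr (3/2) * (y / 2) powr (2 * real m + - (1/3)) = w powr (real (3 * m + 1))"
    proof -
      have "3/2 + 3/2 * (2 * real m + - (1/3)) = real (3 * m + 1)" by (simp add: field_simps)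
      then show ?thesis unfolding y2 powr_powr powr_add[symmetric] by (rule arg_cong)
    qed
    also have "\<dots> = (1/3) ^ (3 * m + 1) * z ^ (3 * m + 1)"
      using w by (subst powr_realpow) (auto simp: w_def power_divide)
    finally have *: "w powr (3/2) * (y / 2) powr (2 * real m + - (1/3)) = (1/3) ^ (3 * m + 1) * z ^ (3 * m + 1)" .
    have arg: "real m + - (1/3) + 1 = real m + 2/3" by simp
    show ?thesis unfolding arg wright_coeff_third_1 times_divide_eq_right mult.assoc[symmetric] times_divide_eq_left *
      by (simp add: mult_ac)
  qed
  have I2: "w powr (3/2) * ((y / 2) powr (2 * real m + 1/3) / fact m * rGamma (real m + 1/3 + 1))
      = - (((- 1) ^ (3 * m + 2) * rGamma (- (1/3) * real (3 * m + 2)) / fact (3 * m + 2)) * z ^ (3 * m + 2))" for m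
  proof -
    have "w powr (3/2) * (y / 2) powr (2 * real m + 1/3) = w powr (real (3 * m + 2))"
    proof -
      have "3/2 + 3/2 * (2 * real m + 1/3) = real (3 * m + 2)" by (simp add: field_simps)
      then show ?thesis unfolding y2 powr_powr powr_add[symmetric] by (rule arg_cong)
    qed
    also have "\<dots> = (1/3) ^ (3 * m + 2) * z ^ (3 * m + 2)"
      using w by (subst powr_realpow) (auto simp: w_def power_divide)
    finally have *: "w powr (3/2) * (y / 2) powr (2 * real m + 1/3) = (1/3) ^ (3 * m + 2) * z ^ (3 * m + 2)" .
    have arg: "real m + 1/3 + 1 = real m + 4/3" by simp
    show ?thesis unfolding arg wright_coeff_third_2 times_divide_eq_right mult.assoc[symmetric] times_divide_eq_left *
      by (simp add: mult_ac)
  qed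
  note F = wright_phi0_mod_3[of "1/3" z, OF disjI1[OF refl]]
  have wne: "w powr (3/2) \<noteq> 0" using w by simp
  have "(\<lambda>m. w powr (3/2) * ((y / 2) powr (2 * real m + - (1/3)) / fact m * rGamma (real m + - (1/3) + 1)))
      sums (\<Sum>m. (- 1) ^ (3 * m + 1) * rGamma (- (1/3) * real (3 * m + 1)) / fact (3 * m + 1) * z ^ (3 * m + 1))"
    unfolding I1 by (rule summable_sums[OF F(2)])
  then have B1: "w powr (3/2) * bessel_I (- (1/3)) y = (\<Sum>m. (- 1) ^ (3 * m + 1) * rGamma (- (1/3) * real (3 * m + 1)) / fact (3 * m + 1) * z ^ (3 * m + 1))"
    unfolding bessel_I_def by (rule suminf_mult_eq[OF _ wne])
  have "(\<lambda>m. w powr (3/2) * ((y / 2) powr (2 * real m + 1/3) / fact m * rGamma (real m + 1/3 + 1)))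
      sums - (\<Sum>m. (- 1) ^ (3 * m + 2) * rGamma (- (1/3) * real (3 * m + 2)) / fact (3 * m + 2) * z ^ (3 * m + 2))"
    unfolding I2 by (intro sums_minus summable_sums[OF F(3)])
  then have B2: "w powr (3/2) * bessel_I (1/3) y = - (\<Sum>m. (- 1) ^ (3 * m + 2) * rGamma (- (1/3) * real (3 * m + 2)) / fact (3 * m + 2) * z ^ (3 * m + 2))"
    unfolding bessel_I_def by (rule suminf_mult_eq[OF _ wne])
  \<comment> \<open>The order is not an integer, so the quotient itself and not its limit is
    taken.\<close>
  have "bessel_K (1/3) y = pi / 2 * (bessel_I (- (1/3)) y - bessel_I (1/3) y) / sin (pi / 3)"
    using one_third_not_Ints by (simp add: bessel_K_def)
  also have "\<dots> = pi / sqrt 3 * (bessel_I (- (1/3)) y - bessel_I (1/3) y)"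
    unfolding sin_60 by simp
  finally have "z powr (3/2) / (3 * pi) * bessel_K (1/3) y = z powr (3/2) / (3 * sqrt 3) * (bessel_I (- (1/3)) y - bessel_I (1/3) y)"
    by simp
  also have "\<dots> = w powr (3/2) * bessel_I (- (1/3)) y - w powr (3/2) * bessel_I (1/3) y"
    unfolding w32 by (simp add: right_diff_distrib)
  also have "\<dots> = wright_phi0 (1/3) z" unfolding B1 B2 F(1) by simp
  finally show ?thesis by (simp add: y_def)
qed

section \<open>The Whittaker case, nu = 2/3\<close>

lemma summable_norm_kummer:
  fixes a b x :: real
  shows "summable (\<lambda>n. norm (pochhammer a n / pochhammer b n * x ^ n / fact n))"
\<comment> \<open>In these cases almost all terms are 0; for b a nonpositive integer this comes from
  division by \<open>pochhammer b n\<close> = 0.\<close>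
proof (cases "x = 0 \<or> a \<in> \<int>\<^sub>\<le>\<^sub>0 \<or> b \<in> \<int>\<^sub>\<le>\<^sub>0")
  case True
  then obtain N where N: "\<And>n. n \<ge> N \<Longrightarrow> pochhammer a n / pochhammer b n * x ^ n / fact n = 0"
  proof (elim disjE)
    assume "x = 0"
    then show ?thesis by (intro that[of 1]) auto
  next
    assume "a \<in> \<int>\<^sub>\<le>\<^sub>0"
    then obtain m where "a = - of_nat m" by (elim nonpos_Ints_cases')
    then show ?thesis by (intro that[of "Suc m"]) (auto simp: pochhammer_of_nat_eq_0_iff)
  next
    assume "b \<in> \<int>\<^sub>\<le>\<^sub>0"
    then obtain m where "b = - of_nat m" by (elim nonpos_Ints_cases')
    then show ?thesis by (intro that[of "Suc m"]) (auto simp: pochhammer_of_nat_eq_0_iff)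
  qed
  then show ?thesis
    by (intro summable_finite[of "{..<N}"]) (auto simp: not_less)
next
  case False
  let ?f = "\<lambda>n. pochhammer a n / pochhammer b n * x ^ n / fact n"
  have ratio: "norm (?f (Suc n)) = \<bar>(a + real n) / (b + real n) * x / (real n + 1)\<bar> * norm (?f n)" for n
    by (simp add: pochhammer_Suc abs_mult mult_ac)
  have "(\<lambda>n. (a + real n) / (b + real n) * x / (real n + 1)) \<longlonglongrightarrow> 0"
    by real_asymp
  then have "eventually (\<lambda>n. norm ((a + real n) / (b + real n) * x / (real n + 1)) < 1/2) sequentially"
    by (intro order_tendstoD(2)[OF tendsto_norm_zero]) auto
  then obtain N where N: "\<And>n. n \<ge> N \<Longrightarrow> \<bar>(a + real n) / (b + real n) * x / (real n + 1)\<bar> < 1/2"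
    unfolding eventually_sequentially by auto
  show ?thesis
  proof (rule summable_ratio_test[of "1/2" N])
    fix n assume "n \<ge> N"
    show "norm (norm (?f (Suc n))) \<le> 1/2 * norm (norm (?f n))"
    proof -
      have "norm (?f (Suc n)) \<le> 1/2 * norm (?f n)"
        unfolding ratio using N[OF \<open>n \<ge> N\<close>] by (intro mult_right_mono) auto
      then show ?thesis by simp
    qed
  qed simp
qed

text \<open>The coefficients of the Cauchy product of the Kummer series with exp (- x) are evaluated
  by the Chu-Vandermonde sum, after n! / (n - i)! has been written as a Pochhammer symbol of -
  n.\<close>

lemma kummer_M_transformation:
  fixes a b x :: real
  assumes b: "b \<notin> \<int>\<^sub>\<le>\<^sub>0"
  shows "exp (- x) * kummer_M a b x = kummer_M (b - a) b (- x)"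
proof -
  let ?A = "\<lambda>n. pochhammer a n / pochhammer b n * x ^ n / fact n"
  let ?B = "\<lambda>n. (- x) ^ n /\<^sub>R fact n"
  have "(\<lambda>n. \<Sum>i\<le>n. ?A i * ?B (n - i)) sums ((\<Sum>n. ?A n) * (\<Sum>n. ?B n))"
    by (rule Cauchy_product_sums[OF summable_norm_kummer summable_norm_exp])
  moreover have "(\<Sum>i\<le>n. ?A i * ?B (n - i)) = pochhammer (b - a) n / pochhammer b n * (- x) ^ n / fact n" for n
  proof -
    have "?A i * ?B (n - i) = (- x) ^ n / fact n *
        (pochhammer a i * pochhammer (- real n) i / (of_nat (fact i) * pochhammer b i))" if i: "i \<le> n" for i
    proof -
      have "(- x) ^ n = (- 1) ^ i * x ^ i * (- x) ^ (n - i)"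
        using i by (simp add: power_add[symmetric] flip: power_mult_distrib)
      moreover have "pochhammer (- real n) i = (- 1) ^ i * (fact n / fact (n - i))"
      proof -
        have "real (n choose i) = (- 1) ^ i * pochhammer (- real n) i / fact i"
          by (simp add: binomial_gbinomial gbinomial_pochhammer)
        then have "(- 1) ^ i * pochhammer (- real n) i = fact n / fact (n - i)"
          using i by (simp add: binomial_fact field_simps)
        then have "(- 1) ^ i * ((- 1) ^ i * pochhammer (- real n) i) = (- 1) ^ i * (fact n / fact (n - i))"
          by (rule arg_cong)
        then show ?thesis by (simp flip: power_mult_distrib mult.assoc)
      qed
      ultimately show ?thesis
        by (simp add: divide_inverse mult_ac flip: power_mult_distrib)
    qed
    then have "(\<Sum>i\<le>n. ?A i * ?B (n - i)) = (- x) ^ n / fact n *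
        (\<Sum>i = 0..n. pochhammer a i * pochhammer (- real n) i / (of_nat (fact i) * pochhammer b i))"
      by (simp add: sum_distrib_left atLeast0AtMost)
    also have "(\<Sum>i = 0..n. pochhammer a i * pochhammer (- real n) i / (of_nat (fact i) * pochhammer b i))
        = pochhammer (b - a) n / pochhammer b n"
      using b by (intro Vandermonde_pochhammer) auto
    finally show ?thesis by (simp add: mult.commute)
  qed
  ultimately have "kummer_M (b - a) b (- x) = (\<Sum>n. ?A n) * (\<Sum>n. ?B n)"
    unfolding kummer_M_def by (simp add: sums_iff)
  also have "\<dots> = kummer_M a b x * exp (- x)"
    by (simp add: kummer_M_def exp_def)
  finally show ?thesis by simp
qed

lemma Gamma_legendre_duplication_real:
  fixes z :: real
  assumes "z > 0"
  shows "Gamma z * Gamma (z + 1/2) = 2 powr (1 - 2 * z) * sqrt pi * Gamma (2 * z)"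
proof -
  have half: "complex_of_real z + 1/2 = of_real (z + 1/2)" and dbl: "2 * complex_of_real z = of_real (2 * z)"
    and ex: "(1 - of_real (2 * z)) * complex_of_real (ln 2) = of_real ((1 - 2 * z) * ln 2)"
    by simp_all
  have "z \<notin> \<int>\<^sub>\<le>\<^sub>0" "z + 1/2 \<notin> \<int>\<^sub>\<le>\<^sub>0"
    using assms by (auto dest: nonpos_Ints_nonpos)
  then have "complex_of_real z \<notin> \<int>\<^sub>\<le>\<^sub>0" "complex_of_real z + 1/2 \<notin> \<int>\<^sub>\<le>\<^sub>0"
    unfolding half by (simp_all only: of_real_in_nonpos_Ints_iff not_False_eq_True)
  from Gamma_legendre_duplication[OF this]
  have "complex_of_real (Gamma z * Gamma (z + 1/2)) = of_real (exp ((1 - 2 * z) * ln 2) * sqrt pi * Gamma (2 * z))"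
    unfolding half dbl ex exp_of_real Gamma_complex_of_real by (simp only: of_real_mult)
  then show ?thesis unfolding of_real_eq_iff by (simp add: powr_def)
qed

text \<open>These identities match the leading coefficients of the two residue classes. Duplication
  at 1/6 and at 1/3 eliminates the Gamma values at 1/6 and 5/6, and reflection at 1/3 relates those
  at 1/3 and 2/3.\<close>

lemma whittaker_W_coeffs:
  shows "sqrt (3 / pi) * Gamma (1/3) * rGamma (1/6) * (4/27) powr (1/3) = - rGamma (- (2/3))"
    and "sqrt (3 / pi) * Gamma (- (1/3)) * rGamma (- (1/6)) * (4/27) powr (2/3) = rGamma (- (4/3)) / 2"
proof -
  define s where "s = sqrt pi"
  define G1 where "G1 = Gamma (1/3 :: real)"
  define G2 where "G2 = Gamma (2/3 :: real)"
  define P where "P = Gamma (1/6 :: real)"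
  define Q where "Q = Gamma (5/6 :: real)"
  define U where "U = 2 powr (1/3 :: real)"
  have pos: "s > 0" "G1 > 0" "G2 > 0" "P > 0" "Q > 0" "U > 0"
    by (auto simp: s_def G1_def G2_def P_def Q_def U_def)
  have refl: "sqrt 3 * G1 * G2 = 2 * s ^ 2"
  proof -
    have "inverse G1 * inverse G2 = sin (pi / 3) / pi"
      using rGamma_reflection_real[of "1/3"] by (simp add: rGamma_inverse_Gamma G1_def G2_def)
    also have "\<dots> = sqrt 3 / (2 * s ^ 2)" by (simp add: sin_60 s_def)
    finally have "sqrt 3 / (2 * s ^ 2) * (G1 * G2) = (inverse G1 * inverse G2) * (G1 * G2)" by simp
    also have "\<dots> = 1" using pos by (simp add: field_simps)
    finally show ?thesis using pos by (simp add: divide_eq_eq)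
  qed
  have UU: "2 powr (2/3) = U ^ 2" "4 powr (1/3) = U ^ 2" "4 powr (2/3) = 2 * U"
  proof -
    have 4: "(4 :: real) = 2 powr 2" by simp
    have "U ^ 2 = U powr real 2" using pos by (subst powr_realpow) simp_all
    also have "\<dots> = 2 powr (2/3)" unfolding U_def powr_powr by simp
    finally show "2 powr (2/3) = U ^ 2" by (rule sym)
    then show "4 powr (1/3) = U ^ 2" unfolding 4 powr_powr by simp
    have "2 powr (1 + 1/3 :: real) = 2 * U" unfolding powr_add U_def by simp
    then show "4 powr (2/3) = 2 * U" unfolding 4 powr_powr by simp
  qed
  have PG: "P * G2 = U ^ 2 * s * G1"
    using Gamma_legendre_duplication_real[of "1/6"] by (simp add: P_def G2_def G1_def s_def UU)
  have QG: "G1 * Q = U * s * G2"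
    using Gamma_legendre_duplication_real[of "1/3"] by (simp add: Q_def G2_def G1_def s_def U_def)
  have 27: "27 powr (1/3 :: real) = 3" "27 powr (2/3 :: real) = 9"
  proof -
    have 27: "(27 :: real) = 3 powr 3" by simp
    show "27 powr (1/3 :: real) = 3" "27 powr (2/3 :: real) = 9"
      unfolding 27 powr_powr by simp_all
  qed
  have rG: "rGamma u = 1 / Gamma u" for u :: real
    by (simp add: rGamma_inverse_Gamma inverse_eq_divide)
  \<comment> \<open>All negative arguments are shifted into the interval from 0 to 1, where only G1,
    G2, P and Q occur.\<close>
  have sh: "rGamma (- (2/3)) = - (2/3) * rGamma (1/3 :: real)" "rGamma (- (4/3)) = - (4/3) * rGamma (- (1/3) :: real)"
    "rGamma (- (1/3)) = - (1/3) * rGamma (2/3 :: real)" "rGamma (- (1/6)) = - (1/6) * rGamma (5/6 :: real)"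
    by (rule rGamma_plus1_cong, simp)+
  have 1: "- rGamma (- (2/3)) = 2 / 3 / G1"
    unfolding sh rG[of "1/3"] G1_def by simp
  have 2: "rGamma (- (4/3)) = 4 / 9 / G2"
    unfolding sh rG[of "2/3"] G2_def by simp
  have "Gamma (- (1/3) :: real) = inverse (rGamma (- (1/3)))" by (simp add: Gamma_def)
  also have "\<dots> = - 3 * G2" unfolding sh rG[of "2/3"] G2_def by simp
  finally have 3: "Gamma (- (1/3)) = - 3 * G2" .
  have 4: "rGamma (- (1/6)) = - (1/6) / Q"
    unfolding sh rG[of "5/6"] Q_def by simp
  have 5: "rGamma (1/6) = 1 / P" unfolding rG P_def ..
  show "sqrt (3 / pi) * Gamma (1/3) * rGamma (1/6) * (4/27) powr (1/3) = - rGamma (- (2/3))"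
  proof -
    \<comment> \<open>The extra factor \<open>G2\<close> makes \<open>refl\<close> and
      \<open>PG\<close> applicable and is cancelled afterwards.\<close>
    have "(sqrt 3 * G1 * U ^ 2 * G1) * G2 = (sqrt 3 * G1 * G2) * (U ^ 2 * G1)" by simp
    also have "\<dots> = 2 * s * (P * G2)" unfolding refl PG by (simp add: power2_eq_square)
    finally have "sqrt 3 * G1 * U ^ 2 * G1 = 2 * s * P" using pos by simp
    moreover have "sqrt 3 / s * G1 * (1 / P) * (U ^ 2 / 3) = sqrt 3 * G1 * U ^ 2 * G1 / (3 * s * P * G1)"
      using pos by simp
    ultimately have "sqrt 3 / s * G1 * (1 / P) * (U ^ 2 / 3) = 2 * s * P / (3 * s * P * G1)" by simp
    then show ?thesis
      unfolding 1 5 powr_divide[of 4 27] UU 27 G1_def[symmetric] real_sqrt_divide s_def[symmetric]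
      using pos by simp
  qed
  show "sqrt (3 / pi) * Gamma (- (1/3)) * rGamma (- (1/6)) * (4/27) powr (2/3) = rGamma (- (4/3)) / 2"
  proof -
    have "(sqrt 3 * G2 * U * G2) * G1 = (sqrt 3 * G1 * G2) * (U * G2)" by simp
    also have "\<dots> = 2 * s * (G1 * Q)" unfolding refl QG by (simp add: power2_eq_square)
    finally have "sqrt 3 * G2 * U * G2 = 2 * s * Q" using pos by simp
    moreover have "sqrt 3 / s * (- 3 * G2) * (- (1/6) / Q) * (2 * U / 9) = sqrt 3 * G2 * U * G2 / (9 * s * Q * G2)"
      using pos by (simp add: mult_ac)
    ultimately have "sqrt 3 / s * (- 3 * G2) * (- (1/6) / Q) * (2 * U / 9) = 2 * s * Q / (9 * s * Q * G2)" by simp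
    then show ?thesis
      unfolding 2 3 4 powr_divide[of 4 27] UU 27 real_sqrt_divide s_def[symmetric]
      using pos by simp
  qed
qed


text \<open>With y = 4 z^3 / 27 the given exponential is exp (- y / 2), and the Whittaker functions
  M supply another one. Kummer's transformation uses up their product exp (- y) and yields series in
  - y, as the Wright coefficients require. The powers y^(1/3) and y^(2/3) supply the leading z and
  z^2 of the two residue classes.\<close>

lemma wright_phi0_two_thirds:
  assumes z: "z > 0"
  shows "sqrt (3 / pi) * (exp (- (2 * z ^ 3) / 27) * whittaker_W (1/2) (1/6) (4 * z ^ 3 / 27)) = wright_phi0 (2/3) z"
proof -
  define y where "y = 4 * z ^ 3 / 27"
  have y: "y > 0" using z by (simp add: y_def)
  note F = wright_phi0_mod_3[of "2/3" z, OF disjI2[OF refl], unfolded wright_coeff_two_thirds_1 wright_coeff_two_thirds_2]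
  have zm: "(- (4/27)) ^ m * z ^ (3 * m) = (- y) ^ m" for m
  proof -
    have "(- (4/27)) ^ m * z ^ (3 * m) = (- (4/27) * z ^ 3) ^ m"
      by (simp only: power_mult power_mult_distrib)
    then show ?thesis by (simp add: y_def)
  qed
  have y13: "y powr (1/3) = (4/27) powr (1/3) * z" "y powr (2/3) = (4/27) powr (2/3) * z ^ 2"
  proof -
    have "z ^ 3 = z powr 3" "z ^ 2 = z powr 2" using z by (simp_all add: powr_numeral)
    then have "(z ^ 3) powr (1/3) = z" "(z ^ 3) powr (2/3) = z ^ 2"
      using z by (simp_all only: powr_powr) simp_all
    moreover have "y = 4/27 * z ^ 3" by (simp add: y_def)
    ultimately show "y powr (1/3) = (4/27) powr (1/3) * z" "y powr (2/3) = (4/27) powr (2/3) * z ^ 2"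
      using z by (simp_all only: powr_mult)
  qed
  have S1: "(\<Sum>m. - rGamma (- (2/3)) * (pochhammer (5/6) m / pochhammer (2/3) m * (- (4/27)) ^ m / fact m) * z ^ (3 * m + 1))
      = - rGamma (- (2/3)) * z * kummer_M (5/6) (2/3) (- y)"
  proof -
    have "- rGamma (- (2/3)) * (pochhammer (5/6) m / pochhammer (2/3) m * (- (4/27)) ^ m / fact m) * z ^ (3 * m + 1)
       = - rGamma (- (2/3)) * z * (pochhammer (5/6) m / pochhammer (2/3) m * (- y) ^ m / fact m)" for m
      unfolding zm[symmetric] power_add by (simp add: mult_ac)
    then show ?thesis
      unfolding kummer_M_def by (simp only: suminf_mult[OF summable_norm_cancel[OF summable_norm_kummer]])
  qed
  have S2: "(\<Sum>m. rGamma (- (4/3)) / 2 * (pochhammer (7/6) m / pochhammer (4/3) m * (- (4/27)) ^ m / fact m) * z ^ (3 * m + 2))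
      = rGamma (- (4/3)) / 2 * z ^ 2 * kummer_M (7/6) (4/3) (- y)"
  proof -
    have "rGamma (- (4/3)) / 2 * (pochhammer (7/6) m / pochhammer (4/3) m * (- (4/27)) ^ m / fact m) * z ^ (3 * m + 2)
       = rGamma (- (4/3)) / 2 * z ^ 2 * (pochhammer (7/6) m / pochhammer (4/3) m * (- y) ^ m / fact m)" for m
      unfolding zm[symmetric] power_add by (simp add: mult_ac)
    then show ?thesis
      unfolding kummer_M_def by (simp only: suminf_mult[OF summable_norm_cancel[OF summable_norm_kummer]])
  qed
  have ni: "(2/3 :: real) \<notin> \<int>\<^sub>\<le>\<^sub>0" "(4/3 :: real) \<notin> \<int>\<^sub>\<le>\<^sub>0"
    by (auto dest: nonpos_Ints_nonpos)
  have e: "exp (- (2 * z ^ 3) / 27) * exp (- y / 2) = exp (- y)"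
    by (simp add: y_def flip: exp_add)
  have "whittaker_W (1/2) (1/6) y = Gamma (- (1/3)) * rGamma (- (1/6)) * whittaker_M (1/2) (1/6) y
        + Gamma (1/3) * rGamma (1/6) * whittaker_M (1/2) (- (1/6)) y"
    using one_third_not_Ints by (simp add: whittaker_W_def)
  also have "\<dots> = exp (- y / 2) * (Gamma (- (1/3)) * rGamma (- (1/6)) * y powr (2/3) * kummer_M (1/6) (4/3) y
        + Gamma (1/3) * rGamma (1/6) * y powr (1/3) * kummer_M (- (1/6)) (2/3) y)"
    by (simp add: whittaker_M_def algebra_simps)
  finally have W: "exp (- (2 * z ^ 3) / 27) * whittaker_W (1/2) (1/6) y =
      Gamma (- (1/3)) * rGamma (- (1/6)) * y powr (2/3) * (exp (- y) * kummer_M (1/6) (4/3) y)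
        + Gamma (1/3) * rGamma (1/6) * y powr (1/3) * (exp (- y) * kummer_M (- (1/6)) (2/3) y)"
    unfolding e[symmetric] by (simp add: algebra_simps)
  have "sqrt (3 / pi) * (exp (- (2 * z ^ 3) / 27) * whittaker_W (1/2) (1/6) y)
     = (sqrt (3 / pi) * Gamma (- (1/3)) * rGamma (- (1/6)) * (4/27) powr (2/3)) * z ^ 2 * kummer_M (7/6) (4/3) (- y)
     + (sqrt (3 / pi) * Gamma (1/3) * rGamma (1/6) * (4/27) powr (1/3)) * z * kummer_M (5/6) (2/3) (- y)"
    unfolding W kummer_M_transformation[OF ni(1)] kummer_M_transformation[OF ni(2)] y13
    by (simp add: algebra_simps)
  also have "\<dots> = wright_phi0 (2/3) z"
    unfolding whittaker_W_coeffs F(1) S1 S2 by simp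
  finally show ?thesis by (simp add: y_def)
qed

text \<open>Since c is nonzero, integrability also passes back from g to f; this lets both formulas
  be read off from a pointwise identity on t > 0.\<close>

lemma set_integral_rescale:
  fixes c :: real
  assumes "c \<noteq> 0" and eq: "\<And>t. t > 0 \<Longrightarrow> c * f t = g t"
    and g: "set_integrable lborel {0<..} g" "(LBINT t:{0<..}. g t) = w"
  shows "set_integrable lborel {0<..} f \<and> w = c * (LBINT t:{0<..}. f t)"
proof
  have f: "f t = 1 / c * g t" if "t > 0" for t
    using eq[OF that] \<open>c \<noteq> 0\<close> by (simp add: field_simps)
  have "set_integrable lborel {0<..} (\<lambda>t. 1 / c * g t)"
    by (intro set_integrable_mult_right g)
  then show "set_integrable lborel {0<..} f"
    by (rule set_integrable_cong[THEN iffD1, rotated -1]) (simp_all add: f)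
  have "(LBINT t:{0<..}. g t) = (LBINT t:{0<..}. c * f t)"
    unfolding set_lebesgue_integral_def
    by (intro Bochner_Integration.integral_cong) (auto simp: eq indicator_def)
  then show "w = c * (LBINT t:{0<..}. f t)" using g(2) by simp
qed

theorem theorem1:
  fixes x :: real and k :: nat
  assumes "x > 0" and "k > 0"
  shows "set_integrable lborel {0<..}
           (\<lambda>t. exp (- t) * t powr (real k - 3/2)
                * bessel_K (1/3) (2 * x powr (3/2) / (3 * sqrt (3 * t))))
       \<and> wright_Psi11 (- 1/3) k (- x) =
           x powr (3/2) / (3 * pi) *
           (LBINT t:{0<..}. exp (- t) * t powr (real k - 3/2)
                * bessel_K (1/3) (2 * x powr (3/2) / (3 * sqrt (3 * t))))
       \<and> set_integrable lborel {0<..}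
           (\<lambda>t. exp (- t) * t powr (real k - 1) * exp (- (2 * x ^ 3) / (27 * t\<^sup>2))
                * whittaker_W (1/2) (1/6) (4 * x ^ 3 / (27 * t\<^sup>2)))
       \<and> wright_Psi11 (- 2/3) k (- x) =
           sqrt (3 / pi) *
           (LBINT t:{0<..}. exp (- t) * t powr (real k - 1) * exp (- (2 * x ^ 3) / (27 * t\<^sup>2))
                * whittaker_W (1/2) (1/6) (4 * x ^ 3 / (27 * t\<^sup>2)))"
proof -
  have third: "x powr (3/2) / (3 * pi) * (exp (- t) * t powr (real k - 3/2)
                * bessel_K (1/3) (2 * x powr (3/2) / (3 * sqrt (3 * t))))
      = exp (- t) * t powr (real k - 1) * wright_phi0 (1/3) (x * t powr - (1/3))" if t: "t > 0" for t
  proof -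
    define z where "z = x * t powr - (1/3)"
    have "z > 0" using assms t by (simp add: z_def)
    \<comment> \<open>The prefactor z^(3/2) contributes t^(- 1/2), which turns the exponent k - 1
      into k - 3/2.\<close>
    have "z powr (3/2) = x powr (3/2) * t powr - (1/2)"
      unfolding z_def powr_mult powr_powr by simp
    then have z: "z powr (3/2) = x powr (3/2) / sqrt t"
      unfolding powr_minus powr_half_sqrt[OF less_imp_le[OF t]] by (simp only: divide_inverse)
    have "t powr (real k - 3/2) = t powr ((real k - 1) - 1/2)" by simp
    also have "\<dots> = t powr (real k - 1) / sqrt t"
      unfolding powr_diff[of t "real k - 1"] using t by (simp add: powr_half_sqrt)
    finally have tk: "t powr (real k - 3/2) = t powr (real k - 1) / sqrt t" .
    show ?thesis
      unfolding z_def[symmetric] wright_phi0_third[OF \<open>z > 0\<close>, symmetric] z tk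
      by (simp add: real_sqrt_mult mult_ac)
  qed
  have two_thirds: "sqrt (3 / pi) * (exp (- t) * t powr (real k - 1) * exp (- (2 * x ^ 3) / (27 * t\<^sup>2))
                * whittaker_W (1/2) (1/6) (4 * x ^ 3 / (27 * t\<^sup>2)))
      = exp (- t) * t powr (real k - 1) * wright_phi0 (2/3) (x * t powr - (2/3))" if t: "t > 0" for t
  proof -
    define z where "z = x * t powr - (2/3)"
    have "z > 0" using assms t by (simp add: z_def)
    have "(t powr - (2/3)) ^ 3 = (t powr - (2/3)) powr real 3"
      by (rule powr_realpow[symmetric]) (use t in simp)
    also have "\<dots> = inverse (t powr real 2)" unfolding powr_powr by (simp flip: powr_minus)
    also have "\<dots> = inverse (t ^ 2)" using t by (subst powr_realpow) auto
    finally have z: "z ^ 3 = x ^ 3 / t ^ 2" unfolding z_def power_mult_distrib divide_inverse by (rule arg_cong)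
    show ?thesis
      unfolding z_def[symmetric] wright_phi0_two_thirds[OF \<open>z > 0\<close>, symmetric] z
      by (simp add: mult_ac)
  qed
  have "x powr (3/2) / (3 * pi) \<noteq> 0" "sqrt (3 / pi) \<noteq> 0" using assms by auto
  then show ?thesis
    using set_integral_rescale[OF _ third wright_phi0_laplace[of "1/3" x k]]
      set_integral_rescale[OF _ two_thirds wright_phi0_laplace[of "2/3" x k]] assms
    unfolding minus_divide_left[symmetric] by auto
qed

end
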